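(* Let $Q\subset\mathbf{P}^n$ be a smooth quadric and let $\mathcal{D}=\{Q\}$. Then $$\Omega^1_{\mathbf{P}^n}(\log\mathcal{D})\cong \mathbf{TP}^n(-2).$$
   Context: Everything is over $\mathbf{C}$. $\mathbf{TP}^n$ is the tangent bundle of $\mathbf{P}^n$ and $\mathbf{TP}^n(-2)=\mathbf{TP}^n\otimes\mathcal{O}_{\mathbf{P}^n}(-2)$. An arrangement on a smooth algebraic variety $X$ is a family $\mathcal{D}=\{D_1,\ldots,D_\ell\}$ of pairwise distinct smooth irreducible hypersurfaces of $X$; it has normal crossings if it is locally isomorphic (under holomorphic local coordinate changes) to a union of coordinate hyperplanes of $\mathbf{C}^n$, $n=\dim X$ (automatic for a single smooth hypersurface). For $\mathcal{D}$ with normal crossings, let $U=X\setminus\bigcup_i D_i$ and $j:U\hookrightarrow X$ the inclusion. The logarithmic bundle $\Omega^1_X(\log\mathcal{D})$ is the subsheaf of $j_*\Omega^1_U$ whose sections, near a point $x$ where $\mathcal{D}=\{z_1\cdots z_k=0\}$ in local coordinates $z_1,\ldots,z_n$, are the forms $\sum_{i=1}^k u_i\,\frac{dz_i}{z_i}+\sum_{i=k+1}^n v_i\,dz_i$ with $u_i,v_i$ holomorphic. It is locally free of rank $n$. *)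

theory Defs
  imports "HOL-Analysis.Analysis"
begin

section \<open>Holomorphic functions of several variables\<close>

text \<open>Meant for open \<open>S\<close>: complex Frechet differentiability at every point.\<close>

definition holo_on :: "(complex^'n::finite \<Rightarrow> complex) \<Rightarrow> (complex^'n) set \<Rightarrow> bool" where
  "holo_on f S \<longleftrightarrow> (\<forall>x\<in>S. \<exists>D. (f has_derivative D) (at x) \<and> Vector_Spaces.linear (*s) (*) D)"

section \<open>Complex manifolds\<close>

text \<open>
  A complex manifold of dimension \<open>CARD('n)\<close> on the points of a type \<open>'a\<close> is given by an atlas
  indexed by \<open>'i\<close>: chart \<open>i\<close> is \<open>coord X i\<close>, used only on \<open>chart_dom X i\<close>.  The topology is the one
  induced by the charts.
\<close>

record ('a, 'i, 'n) atlas =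
  chart_dom :: "'i \<Rightarrow> 'a set"
  coord :: "'i \<Rightarrow> 'a \<Rightarrow> complex^'n"

definition param :: "('a, 'i, 'n::finite) atlas \<Rightarrow> 'i \<Rightarrow> complex^'n \<Rightarrow> 'a" where
  "param X i = the_inv_into (chart_dom X i) (coord X i)"

definition mopen :: "('a, 'i, 'n::finite) atlas \<Rightarrow> 'a set \<Rightarrow> bool" where
  "mopen X U \<longleftrightarrow> (\<forall>i. open (coord X i ` (U \<inter> chart_dom X i)))"

definition mholo_on :: "('a, 'i, 'n::finite) atlas \<Rightarrow> ('a \<Rightarrow> complex) \<Rightarrow> 'a set \<Rightarrow> bool" where
  "mholo_on X f U \<longleftrightarrow> (\<forall>i. holo_on (f \<circ> param X i) (coord X i ` (U \<inter> chart_dom X i)))"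

text \<open>Holomorphic local coordinates \<open>z\<close> on \<open>W\<close>: a biholomorphic map onto an open set.\<close>

definition local_coords :: "('a, 'i, 'n::finite) atlas \<Rightarrow> 'a set \<Rightarrow> ('a \<Rightarrow> complex^'n) \<Rightarrow> bool" where
  "local_coords X W z \<longleftrightarrow>
     mopen X W \<and> open (z ` W) \<and> inj_on z W \<and>
     (\<forall>k. mholo_on X (\<lambda>p. z p $ k) W) \<and>
     (\<forall>i k. holo_on (\<lambda>y. coord X i (the_inv_into W z y) $ k) (z ` (W \<inter> chart_dom X i)))"

section \<open>Holomorphic vector bundles and their sheaves of sections\<close>

text \<open>
  A vector bundle of rank \<open>CARD('r)\<close>, trivialised over the chart domains, is given by its
  transition matrices \<open>E i j p\<close>; a section \<open>s\<close> has component \<open>s i\<close> in the \<open>i\<close>-th trivialisation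
  and \<open>s i = E i j *v s j\<close> on overlaps.  Components are set to \<open>0\<close> where they are not defined, so
  that a section over \<open>U\<close> is determined as a HOL function.
\<close>

type_synonym ('a, 'i, 'r) vbundle = "'i \<Rightarrow> 'i \<Rightarrow> 'a \<Rightarrow> complex^'r^'r"
type_synonym ('a, 'i) line_bundle = "'i \<Rightarrow> 'i \<Rightarrow> 'a \<Rightarrow> complex"
type_synonym ('a, 'i, 'r) sect = "'i \<Rightarrow> 'a \<Rightarrow> complex^'r"

definition sections ::
  "('a, 'i, 'n::finite) atlas \<Rightarrow> ('a, 'i, 'r::finite) vbundle \<Rightarrow> 'a set \<Rightarrow> ('a, 'i, 'r) sect set" where
  "sections X E U = {s.
     (\<forall>i p. p \<notin> U \<inter> chart_dom X i \<longrightarrow> s i p = 0) \<and>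
     (\<forall>i k. mholo_on X (\<lambda>p. s i p $ k) (U \<inter> chart_dom X i)) \<and>
     (\<forall>i j. \<forall>p \<in> U \<inter> chart_dom X i \<inter> chart_dom X j. s i p = E i j p *v s j p)}"

definition tangent_bundle :: "('a, 'i, 'n::finite) atlas \<Rightarrow> ('a, 'i, 'n) vbundle" where
  "tangent_bundle X i j p =
     matrix (frechet_derivative (coord X i \<circ> param X j) (at (coord X j p)))"

text \<open>The dual has transition matrices inverse transpose to those of \<open>E\<close>, and
  \<open>E j i p\<close> is inverse to \<open>E i j p\<close>.\<close>

definition dual_bundle :: "('a, 'i, 'r::finite) vbundle \<Rightarrow> ('a, 'i, 'r) vbundle" where
  "dual_bundle E i j p = transpose (E j i p)"

definition tensor_line ::
  "('a, 'i, 'r::finite) vbundle \<Rightarrow> ('a, 'i) line_bundle \<Rightarrow> ('a, 'i, 'r) vbundle" where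
  "tensor_line E L i j p = mat (L i j p) ** E i j p"

definition restr :: "'a set \<Rightarrow> ('a, 'i, 'r::finite) sect \<Rightarrow> ('a, 'i, 'r) sect" where
  "restr V s = (\<lambda>i p. if p \<in> V then s i p else 0)"

text \<open>Isomorphism of sheaves of modules over the sheaf of holomorphic functions.\<close>

definition sheaf_iso ::
  "('a, 'i, 'n::finite) atlas \<Rightarrow> ('a set \<Rightarrow> ('a, 'i, 'r::finite) sect set) \<Rightarrow>
   ('a set \<Rightarrow> ('a, 'i, 't::finite) sect set) \<Rightarrow> bool" where
  "sheaf_iso X S T \<longleftrightarrow> (\<exists>F. \<forall>U. mopen X U \<longrightarrow>
     bij_betw (F U) (S U) (T U) \<and>
     (\<forall>s\<in>S U. \<forall>t\<in>S U. F U (\<lambda>i p. s i p + t i p) = (\<lambda>i p. F U s i p + F U t i p)) \<and>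
     (\<forall>f. \<forall>s\<in>S U. mholo_on X f U \<longrightarrow> F U (\<lambda>i p. f p *s s i p) = (\<lambda>i p. f p *s F U s i p)) \<and>
     (\<forall>V s. mopen X V \<and> V \<subseteq> U \<and> s \<in> S U \<longrightarrow> F V (restr V s) = restr V (F U s)))"

section \<open>Logarithmic forms\<close>

abbreviation one_forms ::
  "('a, 'i, 'n::finite) atlas \<Rightarrow> 'a set \<Rightarrow> ('a, 'i, 'n) sect set" where
  "one_forms X \<equiv> sections X (dual_bundle (tangent_bundle X))"

definition differential ::
  "('a, 'i, 'n::finite) atlas \<Rightarrow> ('a \<Rightarrow> complex) \<Rightarrow> ('a, 'i, 'n) sect" where
  "differential X f i p =
     (\<chi> k. frechet_derivative (f \<circ> param X i) (at (coord X i p)) (axis k 1))"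

text \<open>
  \<open>D\<close> is a family of hypersurfaces with normal crossings.  Sections over \<open>U\<close> of the direct image
  of the sheaf of 1-forms on the complement are the 1-forms on \<open>U - \<Union>D\<close>.  The set \<open>K\<close> plays the
  role of the indices \<open>{1..k}\<close>, and \<open>u\<close> collects both kinds of coefficients.
\<close>

definition log_forms ::
  "('a, 'i, 'n::finite) atlas \<Rightarrow> 'a set set \<Rightarrow> 'a set \<Rightarrow> ('a, 'i, 'n) sect set" where
  "log_forms X D U = {\<omega> \<in> one_forms X (U - \<Union>D).
     \<forall>x\<in>U. \<exists>W z K u.
       x \<in> W \<and> W \<subseteq> U \<and> local_coords X W z \<and>
       W \<inter> \<Union>D = {y \<in> W. \<exists>k\<in>K. z y $ k = 0} \<and>
       (\<forall>k. mholo_on X (u k) W) \<and>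
       (\<forall>i. \<forall>p \<in> (W - \<Union>D) \<inter> chart_dom X i. \<omega> i p =
          (\<Sum>k\<in>K. (u k p / z p $ k) *s differential X (\<lambda>q. z q $ k) i p) +
          (\<Sum>k\<in>-K. u k p *s differential X (\<lambda>q. z q $ k) i p))}"

section \<open>Projective space\<close>

text \<open>
  Points of \<open>'n cproj\<close> are the lines through the origin of the space with coordinates indexed by
  \<open>'n option\<close>; hence the dimension is \<open>n = CARD('n)\<close>.
\<close>

typedef (overloaded) ('n::finite) cproj =
  "{L :: (complex^'n option) set. \<exists>x. x \<noteq> 0 \<and> L = vec.span {x}}"
  by (rule exI[of _ "vec.span {1}"]) (auto intro!: exI[of _ 1])

definition hcoord :: "('n::finite) cproj \<Rightarrow> complex^'n option" where
  "hcoord p = (SOME x. x \<noteq> 0 \<and> x \<in> Rep_cproj p)"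

text \<open>\<open>other i\<close> enumerates the homogeneous coordinates different from the \<open>i\<close>-th.\<close>

fun other :: "'n option \<Rightarrow> 'n \<Rightarrow> 'n option" where
  "other None j = Some j"
| "other (Some k) j = (if j = k then None else Some j)"

definition proj_space :: "('n::finite cproj, 'n option, 'n) atlas" where
  "proj_space = \<lparr>
     chart_dom = (\<lambda>i. {p. hcoord p $ i \<noteq> 0}),
     coord = (\<lambda>i p. \<chi> j. hcoord p $ other i j / hcoord p $ i)\<rparr>"

text \<open>
  A homogeneous function \<open>F\<close> of degree \<open>d\<close> has component \<open>F / (x\<^sub>i)^d\<close> in the \<open>i\<close>-th trivialisation
  of the line bundle of degree \<open>d\<close>.
\<close>

definition proj_O :: "int \<Rightarrow> ('n::finite cproj, 'n option) line_bundle" where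
  "proj_O d i j p = (hcoord p $ j / hcoord p $ i) powi d"

definition quadratic_form :: "(complex^'m::finite \<Rightarrow> complex) \<Rightarrow> bool" where
  "quadratic_form q \<longleftrightarrow> (\<exists>a. \<forall>x. q x = (\<Sum>i\<in>UNIV. \<Sum>j\<in>UNIV. a i j * x $ i * x $ j))"

definition smooth_quadric :: "('n::finite) cproj set \<Rightarrow> bool" where
  "smooth_quadric Q \<longleftrightarrow> (\<exists>q. quadratic_form q \<and>
     Q = {p. \<forall>x \<in> Rep_cproj p. q x = 0} \<and>
     (\<forall>x. x \<noteq> 0 \<and> q x = 0 \<longrightarrow> \<not> (q has_derivative (\<lambda>_. 0)) (at x)))"

end

theory Submission
  imports Defs "HOL-Complex_Analysis.Complex_Analysis"
begin

text \<open>
  Let \<open>x\<^sup>T A x = 0\<close> be the quadric.  A section of the twisted tangent bundle is a vector field \<open>v\<close>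
  of degree \<open>-1\<close> on the cone modulo the Euler field \<open>x\<close>, and the polarity sends it to the form
  \<open>\<omega> = (A v - (x\<^sup>T A v / q) A x) \<cdot> dx\<close>, which kills \<open>x\<close> and depends only on \<open>v\<close> modulo \<open>x\<close>.  Since
  \<open>A x \<cdot> dx = dq / 2\<close>, this form is logarithmic along the quadric, where \<open>q\<close> can be used as a local
  coordinate.  Conversely \<open>v = A\<^sup>-\<^sup>1 \<omega>\<close> modulo \<open>x\<close> off the quadric; the pole of a logarithmic form is a
  multiple of \<open>dq / q\<close>, which \<open>A\<^sup>-\<^sup>1\<close> sends to a multiple of \<open>x\<close>, so \<open>v\<close> stays bounded and extends
  over the quadric by Riemann's theorem.
\<close>

text \<open>The twist is forced by homogeneity: \<open>dx\<close> has degree 1 and \<open>A\<close>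
  is constant, so \<open>A v . dx\<close> has degree 0 exactly when \<open>v\<close> has degree -1,
  two below an ordinary vector field. In charts, the factor of \<open>proj_O (-2)\<close> cancels
  the squared denominator of the Jacobian and leaves a polynomial cocycle. The obstacle lies in the
  direction from forms to fields. A logarithmic form comes with unspecified coordinates
  \<open>z\<close>, tied to the quadric by an equality of zero sets only; no factorisation of
  \<open>q\<close> through \<open>z\<close> is given. That direction therefore argues with bounds:
  Cauchy estimates along complex lines show that the pole is compensated up to a bounded error.
  Since the map from forms to fields exists only through an extension, the explicit map runs from
  fields to forms, and the isomorphism is its inverse.\<close>

no_notation fps_nth (infixl "$" 75)


section \<open>Complex gradients\<close>

text \<open>Bilinear, without conjugation: the functionals \<open>cdot d\<close> are then exactly
  the complex linear ones, and a symmetric complex matrix gives a symmetric form.\<close>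

definition cdot :: "complex^'n::finite \<Rightarrow> complex^'n \<Rightarrow> complex" where
  "cdot u v = (\<Sum>k\<in>UNIV. u $ k * v $ k)"

lemma cdot_add_left: "cdot (u + v) w = cdot u w + cdot v w"
  and cdot_add_right: "cdot w (u + v) = cdot w u + cdot w v"
  and cdot_diff_left: "cdot (u - v) w = cdot u w - cdot v w"
  and cdot_diff_right: "cdot w (u - v) = cdot w u - cdot w v"
  and cdot_scale_left: "cdot (c *s u) w = c * cdot u w"
  and cdot_scale_right: "cdot w (c *s u) = c * cdot w u"
  and cdot_minus_left: "cdot (- u) w = - cdot u w"
  and cdot_minus_right: "cdot w (- u) = - cdot w u"
  and cdot_commute: "cdot u v = cdot v u"
  and cdot_zero_left [simp]: "cdot 0 v = 0"
  and cdot_zero_right [simp]: "cdot v 0 = 0"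
  by (simp_all add: cdot_def sum.distrib sum_subtractf sum_distrib_left sum_negf algebra_simps)

lemmas cdot_simps = cdot_add_left cdot_add_right cdot_diff_left cdot_diff_right
  cdot_scale_left cdot_scale_right cdot_minus_left cdot_minus_right

lemma cdot_axis_right [simp]: "cdot u (axis k c) = u $ k * c"
  and cdot_axis_left [simp]: "cdot (axis k c) u = c * u $ k"
  by (simp_all add: cdot_def axis_def if_distrib[of "\<lambda>x. _ * x"] if_distrib[of "\<lambda>x. x * _"] cong: if_cong)

lemma cdot_sum_left: "cdot (\<Sum>i\<in>I. f i) w = (\<Sum>i\<in>I. cdot (f i) w)"
  by (induction I rule: infinite_finite_induct) (simp_all add: cdot_add_left)

lemma cdot_eqI: "(\<And>w. cdot u w = cdot v w) \<Longrightarrow> u = v"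
  by (metis cdot_axis_right mult.right_neutral vec_eq_iff)

lemma norm_vector_smult: "norm (c *s x) = norm c * norm (x :: complex^'n::finite)"
  by (simp add: norm_vec_def L2_set_def norm_mult power_mult_distrib real_sqrt_mult
      flip: sum_distrib_left)

lemma norm_cdot_le: "norm (cdot u v) \<le> norm u * norm v"
proof -
  have "norm (cdot u v) \<le> (\<Sum>k\<in>UNIV. \<bar>norm (u $ k)\<bar> * \<bar>norm (v $ k)\<bar>)"
    unfolding cdot_def by (rule order_trans[OF norm_sum]) (simp add: norm_mult)
  also have "\<dots> \<le> L2_set (\<lambda>k. norm (u $ k)) UNIV * L2_set (\<lambda>k. norm (v $ k)) UNIV"
    by (rule L2_set_mult_ineq)
  finally show ?thesis by (simp add: norm_vec_def)
qed

lemma tendsto_cdot [tendsto_intros]: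
  "(f \<longlongrightarrow> a) F \<Longrightarrow> (g \<longlongrightarrow> b) F \<Longrightarrow> ((\<lambda>x. cdot (f x) (g x)) \<longlongrightarrow> cdot a b) F"
  unfolding cdot_def by (intro tendsto_intros)

lemma vec_expand: "(x :: complex^'n::finite) = (\<Sum>i\<in>UNIV. x $ i *s axis i 1)"
  by (simp add: basis_expansion)

text \<open>Asking the real Frechet derivative to have the shape \<open>cdot d\<close> builds in the
  Cauchy-Riemann equations and stores the derivative as a vector, on which the rules of calculus
  become algebra.\<close>

definition has_cgrad :: "(complex^'n::finite \<Rightarrow> complex) \<Rightarrow> complex^'n \<Rightarrow> complex^'n \<Rightarrow> bool" where
  "has_cgrad f d x \<longleftrightarrow> (f has_derivative cdot d) (at x)"

text \<open>The formula is that of \<open>differential\<close>, read in a chart.\<close>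

definition cgrad :: "(complex^'n::finite \<Rightarrow> complex) \<Rightarrow> complex^'n \<Rightarrow> complex^'n" where
  "cgrad f x = (\<chi> k. frechet_derivative f (at x) (axis k 1))"

lemma cgrad_eq: "has_cgrad f d x \<Longrightarrow> cgrad f x = d"
  unfolding has_cgrad_def cgrad_def
  by (drule frechet_derivative_at) (metis (no_types, lifting) cdot_axis_right mult.right_neutral vec_lambda_unique)

text \<open>A complex linear functional is determined by its values on the axes, and these are the
  entries of the gradient.\<close>

lemma holo_on_iff: "holo_on f S \<longleftrightarrow> (\<forall>x\<in>S. \<exists>d. has_cgrad f d x)"
proof -
  have "(\<exists>D. (f has_derivative D) (at x) \<and> Vector_Spaces.linear (*s) (*) D) \<longleftrightarrow>
      (\<exists>d. has_cgrad f d x)" for x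
  proof (intro iffI; elim exE conjE)
    fix D assume D: "(f has_derivative D) (at x)" and lin: "Vector_Spaces.linear (*s) (*) D"
    interpret D: Vector_Spaces.linear "(*s)" "(*)" D by (rule lin)
    have "D h = cdot (\<chi> k. D (axis k 1)) h" for h
      by (subst vec_expand) (simp add: D.sum D.scale cdot_def mult.commute)
    then have "has_cgrad f (\<chi> k. D (axis k 1)) x"
      using D unfolding has_cgrad_def by (metis (no_types, lifting) ext)
    then show "\<exists>d. has_cgrad f d x" ..
  next
    fix d assume "has_cgrad f d x"
    moreover have "Vector_Spaces.linear (*s) (*) (cdot d)"
      by unfold_locales (simp_all add: cdot_simps algebra_simps)
    ultimately show "\<exists>D. (f has_derivative D) (at x) \<and> Vector_Spaces.linear (*s) (*) D"
      unfolding has_cgrad_def by blast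
  qed
  then show ?thesis unfolding holo_on_def by blast
qed

lemma holo_on_cgrad: "holo_on f S \<Longrightarrow> x \<in> S \<Longrightarrow> has_cgrad f (cgrad f x) x"
  by (metis holo_on_iff cgrad_eq)

lemma holo_onI: "(\<And>x. x \<in> S \<Longrightarrow> has_cgrad f (d x) x) \<Longrightarrow> holo_on f S"
  by (auto simp: holo_on_iff)

lemma holo_on_subset: "holo_on f S \<Longrightarrow> T \<subseteq> S \<Longrightarrow> holo_on f T"
  by (auto simp: holo_on_iff)

lemma has_cgrad_transform:
  assumes "has_cgrad f d x" "open S" "x \<in> S" "\<And>y. y \<in> S \<Longrightarrow> f y = g y"
  shows "has_cgrad g d x"
  using assms unfolding has_cgrad_def by (metis has_derivative_transform_within_open)

lemma holo_on_transform:
  assumes "holo_on f S" "open S" "\<And>y. y \<in> S \<Longrightarrow> f y = g y"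
  shows "holo_on g S"
  using assms has_cgrad_transform unfolding holo_on_iff by metis

lemma has_cgrad_continuous: "has_cgrad f d x \<Longrightarrow> isCont f x"
  unfolding has_cgrad_def by (rule has_derivative_continuous)

lemma holo_on_isCont: "holo_on f S \<Longrightarrow> x \<in> S \<Longrightarrow> isCont f x"
  using has_cgrad_continuous unfolding holo_on_iff by blast

lemma holo_on_continuous_on: "holo_on f S \<Longrightarrow> continuous_on S f"
  using holo_on_isCont continuous_at_imp_continuous_on by blast

lemma has_cgrad_const [intro]: "has_cgrad (\<lambda>_. c) 0 x"
  by (simp add: has_cgrad_def cdot_def[abs_def])

lemma has_cgrad_cdot [intro]: "has_cgrad (cdot d) d x"
proof -
  have "bounded_linear (cdot d)"
  proof (rule bounded_linear_intro)
    show "cdot d (r *\<^sub>R v) = r *\<^sub>R cdot d v" for r v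
      by (simp add: cdot_def scaleR_sum_right)
    show "norm (cdot d v) \<le> norm v * norm d" for v
      by (metis norm_cdot_le mult.commute)
  qed (simp add: cdot_simps)
  then show ?thesis
    unfolding has_cgrad_def by (rule bounded_linear_imp_has_derivative)
qed

lemma has_cgrad_nth [intro]: "has_cgrad (\<lambda>y. y $ k) (axis k 1) x"
  using has_cgrad_cdot[of "axis k 1" x] by (simp add: cdot_axis_left[abs_def])

lemma has_cgrad_add:
  "has_cgrad f d x \<Longrightarrow> has_cgrad g e x \<Longrightarrow> has_cgrad (\<lambda>y. f y + g y) (d + e) x"
  unfolding has_cgrad_def
  by (drule (1) has_derivative_add) (simp add: cdot_add_left[abs_def])

lemma has_cgrad_mult:
  "has_cgrad f d x \<Longrightarrow> has_cgrad g e x \<Longrightarrow>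
    has_cgrad (\<lambda>y. f y * g y) (f x *s e + g x *s d) x"
  unfolding has_cgrad_def
  by (drule (1) has_derivative_mult) (simp add: cdot_simps[abs_def] mult.commute)

lemma has_cgrad_diff:
  "has_cgrad f d x \<Longrightarrow> has_cgrad g e x \<Longrightarrow> has_cgrad (\<lambda>y. f y - g y) (d - e) x"
  unfolding has_cgrad_def
  by (drule (1) has_derivative_diff) (simp add: cdot_diff_left[abs_def])

lemma has_cgrad_sum:
  "(\<And>i. i \<in> I \<Longrightarrow> has_cgrad (f i) (d i) x) \<Longrightarrow>
    has_cgrad (\<lambda>y. \<Sum>i\<in>I. f i y) (\<Sum>i\<in>I. d i) x"
  by (induction I rule: infinite_finite_induct) (auto intro: has_cgrad_add)

lemma has_cgrad_inverse:
  assumes "has_cgrad f d x" "f x \<noteq> 0"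
  shows "has_cgrad (\<lambda>y. inverse (f y)) (- inverse (f x ^ 2) *s d) x"
  using Deriv.has_derivative_inverse[where f = f and x = x and S = UNIV, OF assms(2)] assms
  by (simp add: has_cgrad_def cdot_simps[abs_def] power2_eq_square algebra_simps
      flip: inverse_mult_distrib)

lemma has_derivative_vecI:
  fixes f :: "'a::euclidean_space \<Rightarrow> complex^'n::finite"
  assumes "\<And>k. ((\<lambda>x. f x $ k) has_derivative (\<lambda>h. D h $ k)) (at x)"
  shows "(f has_derivative D) (at x)"
  unfolding has_derivative_componentwise_within[of f]
  using assms by (auto simp: Basis_vec_def inner_axis intro!: derivative_eq_intros)

lemma has_cgrad_compose:
  fixes \<phi> :: "complex^'m::finite \<Rightarrow> complex^'n::finite"
  assumes "has_cgrad f d (\<phi> x)" "\<And>k. has_cgrad (\<lambda>y. \<phi> y $ k) (e k) x"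
  shows "has_cgrad (\<lambda>y. f (\<phi> y)) (\<Sum>k\<in>UNIV. d $ k *s e k) x"
proof -
  have "(\<phi> has_derivative (\<lambda>h. \<chi> k. cdot (e k) h)) (at x)"
    by (rule has_derivative_vecI) (use assms(2) in \<open>simp add: has_cgrad_def\<close>)
  from has_derivative_compose[OF this assms(1)[unfolded has_cgrad_def]]
  show ?thesis
    by (simp add: has_cgrad_def cdot_sum_left[abs_def] cdot_scale_left cdot_def[of d])
qed

lemma has_cgrad_line:
  assumes "has_cgrad f d (a + t *s u)"
  shows "((\<lambda>t. f (a + t *s u)) has_field_derivative cdot d u) (at t)"
proof -
  have "((\<lambda>t. a + t *s u) has_derivative (\<lambda>h. h *s u)) (at t)"
    by (rule has_derivative_vecI) (auto intro!: derivative_eq_intros simp: algebra_simps)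
  from has_derivative_compose[OF this assms[unfolded has_cgrad_def]]
  show ?thesis by (simp add: has_field_derivative_def cdot_scale_right mult.commute[of _ "cdot d u"])
qed

section \<open>Closure properties of holomorphic functions and restriction to complex lines\<close>

lemma holo_on_const: "holo_on (\<lambda>_. c) S"
  and holo_on_nth: "holo_on (\<lambda>y. y $ k) S"
  and holo_on_add: "holo_on f S \<Longrightarrow> holo_on g S \<Longrightarrow> holo_on (\<lambda>y. f y + g y) S"
  and holo_on_diff: "holo_on f S \<Longrightarrow> holo_on g S \<Longrightarrow> holo_on (\<lambda>y. f y - g y) S"
  and holo_on_mult: "holo_on f S \<Longrightarrow> holo_on g S \<Longrightarrow> holo_on (\<lambda>y. f y * g y) S"
  and holo_on_inverse: "holo_on f S \<Longrightarrow> (\<And>y. y \<in> S \<Longrightarrow> f y \<noteq> 0) \<Longrightarrow> holo_on (\<lambda>y. inverse (f y)) S"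
  unfolding holo_on_iff
  by (blast intro: has_cgrad_add has_cgrad_diff has_cgrad_mult
      has_cgrad_inverse)+

lemma holo_on_divide:
  "holo_on f S \<Longrightarrow> holo_on g S \<Longrightarrow> (\<And>y. y \<in> S \<Longrightarrow> g y \<noteq> 0) \<Longrightarrow> holo_on (\<lambda>y. f y / g y) S"
  unfolding divide_inverse by (intro holo_on_mult holo_on_inverse)

lemma holo_on_sum:
  "(\<And>i. i \<in> I \<Longrightarrow> holo_on (f i) S) \<Longrightarrow> holo_on (\<lambda>y. \<Sum>i\<in>I. f i y) S"
  by (induction I rule: infinite_finite_induct) (auto intro: holo_on_add holo_on_const)

lemma holo_on_cdot:
  "(\<And>k. holo_on (\<lambda>y. f y $ k) S) \<Longrightarrow> (\<And>k. holo_on (\<lambda>y. g y $ k) S) \<Longrightarrow>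
    holo_on (\<lambda>y. cdot (f y) (g y)) S"
  unfolding cdot_def by (intro holo_on_sum holo_on_mult)

lemma holo_on_compose:
  assumes "holo_on f T" "\<And>k. holo_on (\<lambda>y. \<phi> y $ k) S" "\<phi> ` S \<subseteq> T"
  shows "holo_on (\<lambda>y. f (\<phi> y)) S"
  unfolding holo_on_iff
proof
  fix x assume x: "x \<in> S"
  obtain d where "has_cgrad f d (\<phi> x)" using assms(1,3) x unfolding holo_on_iff by blast
  moreover have "has_cgrad (\<lambda>y. \<phi> y $ k) (cgrad (\<lambda>y. \<phi> y $ k) x) x" for k
    using assms(2) x by (rule holo_on_cgrad)
  ultimately show "\<exists>d. has_cgrad (\<lambda>y. f (\<phi> y)) d x"
    using has_cgrad_compose[of f d \<phi> x "\<lambda>k. cgrad (\<lambda>y. \<phi> y $ k) x"] by blast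
qed

text \<open>The bridge to one variable: removable singularities and Cauchy's inequality are applied
  to restrictions to lines.\<close>

lemma holo_on_line:
  assumes "holo_on f S"
  shows "(\<lambda>t. f (a + t *s u)) holomorphic_on {t. a + t *s u \<in> S}"
proof (rule holomorphic_onI)
  fix t assume "t \<in> {t. a + t *s u \<in> S}"
  then obtain d where "has_cgrad f d (a + t *s u)" using assms by (auto simp: holo_on_iff)
  from has_cgrad_line[OF this]
  show "(\<lambda>t. f (a + t *s u)) field_differentiable at t within {t. a + t *s u \<in> S}"
    using field_differentiable_def field_differentiable_at_within by blast
qed

section \<open>Riemann extension in several variables\<close>

lemma bounded_holomorphic_extension:
  assumes hol: "F holomorphic_on (ball 0 R - E)" and fin: "finite E"
    and bd: "\<And>t. t \<in> ball 0 R - E \<Longrightarrow> norm (F t) \<le> M"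
  obtains H where "H holomorphic_on ball 0 R" "\<And>t. t \<in> ball 0 R - E \<Longrightarrow> H t = F t"
    "\<And>t. t \<in> ball 0 R \<Longrightarrow> norm (H t) \<le> M"
proof -
  have "\<exists>H. H holomorphic_on ball 0 R \<and> (\<forall>t\<in>ball 0 R - E \<inter> ball 0 R. H t = F t)"
  proof (rule removable_singularities)
    show "F holomorphic_on ball 0 R - E \<inter> ball 0 R"
      using hol by (simp add: Diff_Int)
    fix z assume z: "z \<in> E \<inter> ball 0 R"
    have "open (ball 0 R - (E - {z}))"
      using fin by (intro open_Diff finite_imp_closed) auto
    then have "\<forall>\<^sub>F t in at z. t \<in> ball 0 R - (E - {z}) - {z}"
      using z by (intro eventually_at_in_open) auto
    then have "\<forall>\<^sub>F t in at z. norm (F t) \<le> M * norm (1 :: complex)"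
      by eventually_elim (use bd in auto)
    then show "F \<in> O[at z](\<lambda>_. 1)" by (rule bigoI)
  qed (use fin in auto)
  then obtain H where H: "H holomorphic_on ball 0 R"
    and eq: "\<And>t. t \<in> ball 0 R - E \<Longrightarrow> H t = F t" by blast
  have "norm (H t) \<le> M" if t: "t \<in> ball 0 R" for t
  proof (rule ccontr)
    assume neg: "\<not> ?thesis"
    \<comment> \<open>The set where the bound fails is open by continuity, yet lies in the finite
      set \<open>E\<close>, so it is empty.\<close>
    have "open (ball 0 R \<inter> H -` {w. M < norm w})"
      using holomorphic_on_imp_continuous_on[OF H]
      by (intro continuous_open_preimage open_Collect_less continuous_intros) auto
    moreover have "ball 0 R \<inter> H -` {w. M < norm w} \<subseteq> E"
      using bd eq by force
    ultimately show False
      using t neg fin finite_imp_not_open[of "ball 0 R \<inter> H -` {w. M < norm w}"]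
      by (metis (no_types, lifting) IntI empty_iff finite_subset mem_Collect_eq not_le vimageI)
  qed
  with H eq that show thesis by blast
qed

text \<open>Both bounds are Cauchy's inequality for the extension \<open>H\<close> of
  \<open>F\<close> across \<open>E\<close>. A circle of radius \<open>R/2\<close> about 0 gives
  \<open>2 * M / R\<close>; circles of radius \<open>R/4\<close> about points of
  \<open>ball 0 (R/2)\<close> bound the second derivative by
  \<open>2 * M / (R/4)\<^sup>2 = 32 * M / R\<^sup>2\<close>, which \<open>field_Taylor\<close> turns
  into the remainder.\<close>

lemma cauchy_estimates_punctured:
  assumes hol: "F holomorphic_on (ball 0 R - E)" and fin: "finite E" "0 \<notin> E" and "0 < R"
    and bd: "\<And>t. t \<in> ball 0 R - E \<Longrightarrow> norm (F t) \<le> M"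
    and der: "(F has_field_derivative F') (at 0)"
  shows "norm F' \<le> 2 * M / R"
    and "\<And>t. t \<in> ball 0 (R/2) - E \<Longrightarrow> norm (F t - F 0 - t * F') \<le> 32 * M / R\<^sup>2 * norm t ^ 2"
proof -
  obtain H where H: "H holomorphic_on ball 0 R" "\<And>t. t \<in> ball 0 R - E \<Longrightarrow> H t = F t"
    "\<And>t. t \<in> ball 0 R \<Longrightarrow> norm (H t) \<le> M"
    using bounded_holomorphic_extension[OF hol fin(1) bd] by blast
  have "open (ball 0 R - E)" using fin by (intro open_Diff finite_imp_closed) auto
  then have H': "deriv H 0 = F'"
    using has_field_derivative_transform_within_open[OF der, of "ball 0 R - E" H] H fin \<open>0 < R\<close>
    by (auto intro!: DERIV_imp_deriv)
  have bound: "norm ((deriv ^^ n) H x) \<le> fact n * M / r ^ n"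
    if "norm x + r < R" "0 < r" for n x r
  proof (rule Cauchy_inequality)
    have sub: "cball x r \<subseteq> ball 0 R" using that by (simp add: cball_subset_ball_iff)
    show "H holomorphic_on ball x r"
      using H(1) sub by (meson ball_subset_cball holomorphic_on_subset order_trans)
    show "continuous_on (cball x r) H"
      using H(1) sub by (meson continuous_on_subset holomorphic_on_imp_continuous_on)
    show "norm (H w) \<le> M" if "norm (x - w) = r" for w
      using sub that by (intro H(3)) (auto simp: dist_norm)
  qed (use that in auto)
  show "norm F' \<le> 2 * M / R"
    using bound[of 0 "R/2" 1] \<open>0 < R\<close> H' by (simp add: field_simps)
  fix t assume t: "t \<in> ball 0 (R/2) - E"
  have "norm ((deriv ^^ 0) H t - (\<Sum>i\<le>1. (deriv ^^ i) H 0 * (t - 0) ^ i / fact i))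
      \<le> (32 * M / R\<^sup>2) * norm (t - 0) ^ Suc 1 / fact 1"
  proof (rule field_Taylor)
    fix i and x :: complex assume x: "x \<in> ball 0 (R/2)"
    show "((deriv ^^ i) H has_field_derivative (deriv ^^ Suc i) H x) (at x within ball 0 (R/2))"
      using holomorphic_derivI[OF holomorphic_higher_deriv[OF H(1)], of x i] x \<open>0 < R\<close>
      by (simp add: has_field_derivative_at_within)
    show "norm ((deriv ^^ Suc 1) H x) \<le> 32 * M / R\<^sup>2"
      using bound[of x "R/4" 2] x \<open>0 < R\<close> by (simp add: field_simps numeral_2_eq_2)
  qed (use t \<open>0 < R\<close> in auto)
  then show "norm (F t - F 0 - t * F') \<le> 32 * M / R\<^sup>2 * norm t ^ 2"
    using H(2)[of t] H(2)[of 0] H' t fin \<open>0 < R\<close> by (simp add: algebra_simps numeral_2_eq_2)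
qed

text \<open>The constants depend on \<open>M\<close> and \<open>R\<close> only, not on the distance
  of \<open>a\<close> from the zeros of \<open>g\<close>; this uniformity survives the passage to
  points where \<open>g\<close> vanishes. Finiteness of the zeros on the line comes from a compact
  disc, so \<open>R\<close> is replaced by \<open>R/2\<close>, which turns 2 into 4 and 32 into
  128.\<close>

lemma holo_line_estimates:
  assumes f: "holo_on f (S \<inter> {y. g y \<noteq> 0})" and g: "holo_on g S" "g a \<noteq> 0"
    and R: "0 < R" "\<And>t. norm t < R \<Longrightarrow> a + t *s u \<in> S"
    and bd: "\<And>t. norm t < R \<Longrightarrow> g (a + t *s u) \<noteq> 0 \<Longrightarrow> norm (f (a + t *s u)) \<le> M"
    and d: "has_cgrad f d a"
  shows "norm (cdot d u) \<le> 4 * M / R"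
    and "\<And>t. norm t < R / 4 \<Longrightarrow> g (a + t *s u) \<noteq> 0 \<Longrightarrow>
      norm (f (a + t *s u) - f a - t * cdot d u) \<le> 128 * M / R\<^sup>2 * norm t ^ 2"
proof -
  define E where "E = {t \<in> cball 0 (R/2). g (a + t *s u) = 0}"
  have sub: "ball 0 R \<subseteq> {t. a + t *s u \<in> S}" using R by auto
  have hg: "(\<lambda>t. g (a + t *s u)) holomorphic_on ball 0 R"
    using holo_on_line[OF g(1)] sub by (rule holomorphic_on_subset)
  have fin: "finite E"
  proof (cases "(\<lambda>t. g (a + t *s u)) constant_on ball 0 R")
    case True
    then obtain c where c: "\<And>t. t \<in> ball 0 R \<Longrightarrow> g (a + t *s u) = c"
      unfolding constant_on_def by blast
    have "E = {}"
      using c[of 0] c g(2) R(1) by (force simp: E_def)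
    then show ?thesis by simp
  next
    case False
    then show ?thesis
      unfolding E_def using R(1) by (intro holomorphic_compact_finite_zeros[OF hg]) auto
  qed
  have hf: "(\<lambda>t. f (a + t *s u)) holomorphic_on ball 0 (R/2) - E"
    using holo_on_line[OF f] by (rule holomorphic_on_subset) (use R in \<open>auto simp: E_def\<close>)
  have der: "((\<lambda>t. f (a + t *s u)) has_field_derivative cdot d u) (at 0)"
    using d by (intro has_cgrad_line) simp
  have zero: "0 \<notin> E" using g by (simp add: E_def)
  have bd': "norm (f (a + t *s u)) \<le> M" if "t \<in> ball 0 (R/2) - E" for t
    using that R by (intro bd) (auto simp: E_def)
  note * = cauchy_estimates_punctured[OF hf fin zero _ bd' der]
  show "norm (cdot d u) \<le> 4 * M / R" using *(1) R by (simp add: field_simps)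
  fix t assume "norm t < R / 4" "g (a + t *s u) \<noteq> 0"
  then show "norm (f (a + t *s u) - f a - t * cdot d u) \<le> 128 * M / R\<^sup>2 * norm t ^ 2"
    using *(2)[of t] R by (simp add: E_def field_simps)
qed

lemma vec_unit_line:
  fixes a b :: "complex^'n::finite"
  assumes "a \<noteq> b"
  obtains u where "norm u = 1" "b = a + of_real (norm (b - a)) *s u"
proof -
  let ?u = "inverse (of_real (norm (b - a))) *s (b - a)"
  have "norm ?u = 1" using assms by (simp only: norm_vector_smult norm_inverse) simp
  moreover have "b = a + of_real (norm (b - a)) *s ?u"
    using assms by (simp only: vector_smult_assoc) simp
  ultimately show thesis by (rule that)
qed

lemma norm_vec_le_card:
  fixes d :: "complex^'n::finite"
  assumes "\<And>k. norm (d $ k) \<le> C"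
  shows "norm d \<le> real CARD('n) * C"
proof -
  have "norm d \<le> (\<Sum>k\<in>UNIV. norm (d $ k))" by (simp add: norm_vec_def L2_set_le_sum)
  also have "\<dots> \<le> real CARD('n) * C" using assms by (intro sum_bounded_above)
  finally show ?thesis .
qed

lemma norm_axis_one [simp]: "norm (axis k (1 :: complex) :: complex^'n::finite) = 1"
  by (simp add: norm_vec_def L2_set_def axis_def if_distrib[of norm] if_distrib[of "\<lambda>x. x\<^sup>2"] cong: if_cong)

text \<open>The estimates along lines are uniform up to the zero set of \<open>g\<close>, so both values and
  gradients of \<open>f\<close> accumulate there and the limit of the Taylor estimate is differentiability.\<close>

lemma limit_cgrad_estimate:
  fixes p :: "complex^'n::finite"
  assumes f: "holo_on f (ball p e \<inter> {y. g y \<noteq> 0})" and g: "holo_on g (ball p e)"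
    and e: "0 < e" and dense: "\<And>r. 0 < r \<Longrightarrow> \<exists>a\<in>ball p r. g a \<noteq> 0"
    and bd: "\<And>y. y \<in> ball p e \<Longrightarrow> g y \<noteq> 0 \<Longrightarrow> norm (f y) \<le> M"
  shows "\<exists>c d C. \<forall>b\<in>ball p (e/16). g b \<noteq> 0 \<longrightarrow> norm (f b - c - cdot d (b - p)) \<le> C * (norm (b - p))\<^sup>2"
proof -
  \<comment> \<open>\<open>holo_line_estimates\<close> with base points in
    \<open>ball p (e/2)\<close> and \<open>R = e/2\<close> gives
    \<open>128 * M / (e/2)\<^sup>2\<close>, valid for steps below \<open>e/8\<close>; any two points
    of \<open>ball p (e/16)\<close> are that close.\<close>
  let ?C = "512 * M / e\<^sup>2"
  have line: "a + t *s u \<in> ball p e" if "a \<in> ball p (e/2)" "norm u = 1" "norm t < e/2" for a t u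
  proof -
    have "dist p (a + t *s u) \<le> dist p a + norm (t *s u)"
      by (metis add_diff_cancel_left' dist_norm dist_triangle norm_minus_commute)
    then show ?thesis using that by (simp add: norm_vector_smult)
  qed
  have g1: "norm (cdot (cgrad f a) u) \<le> 8 * M / e"
    and g2: "norm t < e / 8 \<Longrightarrow> g (a + t *s u) \<noteq> 0 \<Longrightarrow>
      norm (f (a + t *s u) - f a - t * cdot (cgrad f a) u) \<le> ?C * norm t ^ 2"
    if a: "a \<in> ball p (e/2)" "g a \<noteq> 0" and u: "norm u = 1" for a u t
  proof -
    have "a \<in> ball p e" using a e by auto
    then have "has_cgrad f (cgrad f a) a" using f a by (intro holo_on_cgrad) auto
    note * = holo_line_estimates[OF f g a(2) _ line bd this, of "e/2" u]
    show "norm (cdot (cgrad f a) u) \<le> 8 * M / e"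
      using *(1) a u e line by (simp add: field_simps)
    show "norm (f (a + t *s u) - f a - t * cdot (cgrad f a) u) \<le> ?C * norm t ^ 2"
      if "norm t < e / 8" "g (a + t *s u) \<noteq> 0"
      using *(2)[of t] a u e line that by (simp add: field_simps)
  qed
  have est: "norm (f b - f a - cdot (cgrad f a) (b - a)) \<le> ?C * norm (b - a) ^ 2"
    if a: "a \<in> ball p (e/16)" "g a \<noteq> 0" and b: "b \<in> ball p (e/16)" "g b \<noteq> 0" for a b
  proof (cases "a = b")
    case False
    then obtain u where u: "norm u = 1" and bu: "b = a + of_real (norm (b - a)) *s u"
      by (rule vec_unit_line)
    have "b - a = of_real (norm (b - a)) *s u" using bu by (metis add_diff_cancel_left')
    then have "cdot (cgrad f a) (b - a) = of_real (norm (b - a)) * cdot (cgrad f a) u"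
      by (metis cdot_scale_right)
    moreover have "norm (b - a) < e / 8"
      using a b dist_triangle2[of b a p] by (simp add: dist_norm norm_minus_commute)
    moreover have "a \<in> ball p (e/2)" using a e by auto
    ultimately show ?thesis
      using g2[OF _ a(2) u, of "of_real (norm (b - a))"] b(2) bu[symmetric]
      by simp
  qed simp
  have "\<forall>n. \<exists>a. a \<in> ball p (e / 16 / Suc n) \<and> g a \<noteq> 0"
    using dense e by (metis divide_pos_pos of_nat_0_less_iff zero_less_Suc zero_less_numeral)
  then obtain a where a: "\<And>n. a n \<in> ball p (e / 16 / Suc n)" "\<And>n. g (a n) \<noteq> 0" by metis
  have "e / 16 / Suc n \<le> e / 16" for n
    using e by (simp add: divide_le_eq) 
  then have a16: "a n \<in> ball p (e/16)" for n
    using a(1)[of n] by (meson mem_ball order_less_le_trans)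
  then have a2: "a n \<in> ball p (e/2)" "a n \<in> ball p e" for n
    using e a16[of n] zero_le_dist[of p "a n"] unfolding mem_ball by linarith+
  have "bounded (range (\<lambda>n. (f (a n), cgrad f (a n))))"
  proof -
    have "norm (cgrad f (a n)) \<le> real CARD('n) * (8 * M / e)" for n
      using g1[OF a2(1) a(2), of "axis _ 1"] by (intro norm_vec_le_card) simp
    moreover have "norm (f (a n)) \<le> M" for n using a a2 bd by blast
    ultimately have "norm (f (a n), cgrad f (a n)) \<le> M + real CARD('n) * (8 * M / e)" for n
      by (meson add_mono norm_Pair_le order_trans)
    then show ?thesis by (auto intro!: boundedI)
  qed
  then obtain l r where r: "strict_mono r" and lim: "((\<lambda>n. (f (a n), cgrad f (a n))) \<circ> r) \<longlonglongrightarrow> l"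
    using bounded_imp_convergent_subsequence by blast
  have lim1: "(\<lambda>n. f (a (r n))) \<longlonglongrightarrow> fst l" and lim2: "(\<lambda>n. cgrad f (a (r n))) \<longlonglongrightarrow> snd l"
    using tendsto_fst[OF lim] tendsto_snd[OF lim] by (simp_all add: o_def)
  have "a \<longlonglongrightarrow> p"
  proof (rule LIMSEQ_I)
    fix s :: real assume "0 < s"
    then obtain N where N: "e / 16 / s < real N" using reals_Archimedean2 by blast
    have "norm (a n - p) < s" if "N \<le> n" for n
    proof -
      have "norm (a n - p) < e / 16 / Suc n" using a(1)[of n] by (simp add: dist_norm norm_minus_commute)
      also have "\<dots> \<le> s"
        using N that \<open>0 < s\<close> by (simp add: field_simps) (smt (verit) mult_left_mono of_nat_mono)
      finally show ?thesis .
    qed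
    then show "\<exists>N. \<forall>n\<ge>N. norm (a n - p) < s" by blast
  qed
  then have lima: "(\<lambda>n. a (r n)) \<longlonglongrightarrow> p" using LIMSEQ_subseq_LIMSEQ[OF _ r] by (simp add: o_def)
  have "norm (f b - fst l - cdot (snd l) (b - p)) \<le> ?C * (norm (b - p))\<^sup>2"
    if b: "b \<in> ball p (e/16)" "g b \<noteq> 0" for b
  proof (rule LIMSEQ_le)
    show "(\<lambda>n. norm (f b - f (a (r n)) - cdot (cgrad f (a (r n))) (b - a (r n)))) \<longlonglongrightarrow>
        norm (f b - fst l - cdot (snd l) (b - p))"
      by (intro tendsto_intros lim1 lim2 lima)
    show "(\<lambda>n. ?C * (norm (b - a (r n)))\<^sup>2) \<longlonglongrightarrow> ?C * (norm (b - p))\<^sup>2"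
      by (intro tendsto_intros lima)
  qed (use est a16 a b in blast)
  then show ?thesis by blast
qed

text \<open>On the zero set of \<open>g\<close> the extension takes the constant term
  \<open>c\<close> of \<open>limit_cgrad_estimate\<close>, and the quadratic remainder makes it
  differentiable there. Any zero set with dense complement is allowed, smooth or not.\<close>

theorem riemann_extension:
  fixes f g :: "complex^'n::finite \<Rightarrow> complex"
  assumes S: "open S" and f: "holo_on f (S \<inter> {y. g y \<noteq> 0})" and g: "holo_on g S"
    and dense: "\<And>p r. p \<in> S \<Longrightarrow> 0 < r \<Longrightarrow> \<exists>a\<in>ball p r. g a \<noteq> 0"
    and bd: "\<And>p. p \<in> S \<Longrightarrow> g p = 0 \<Longrightarrow> \<exists>e>0. \<exists>M. \<forall>y\<in>ball p e \<inter> S. g y \<noteq> 0 \<longrightarrow> norm (f y) \<le> M"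
  shows "\<exists>h. holo_on h S \<and> (\<forall>y\<in>S. g y \<noteq> 0 \<longrightarrow> h y = f y)"
proof -
  have "\<exists>c d C e. 0 < e \<and> ball p e \<subseteq> S \<and>
      (\<forall>b\<in>ball p e. g b \<noteq> 0 \<longrightarrow> norm (f b - c - cdot d (b - p)) \<le> C * (norm (b - p))\<^sup>2)"
    if p: "p \<in> S" "g p = 0" for p
  proof -
    obtain e1 M where e1: "0 < e1" and M: "\<And>y. y \<in> ball p e1 \<inter> S \<Longrightarrow> g y \<noteq> 0 \<Longrightarrow> norm (f y) \<le> M"
      using bd[OF p] by blast
    obtain e2 where e2: "0 < e2" "ball p e2 \<subseteq> S" using S p open_contains_ball by blast
    define e where "e = min e1 e2"
    have e: "0 < e" "ball p e \<subseteq> S" "ball p e \<subseteq> ball p e1"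
      using e1 e2 by (auto simp: e_def)
    have "\<exists>c d C. \<forall>b\<in>ball p (e/16). g b \<noteq> 0 \<longrightarrow> norm (f b - c - cdot d (b - p)) \<le> C * (norm (b - p))\<^sup>2"
    proof (rule limit_cgrad_estimate)
      show "holo_on f (ball p e \<inter> {y. g y \<noteq> 0})" "holo_on g (ball p e)"
        using f g e by (auto elim!: holo_on_subset)
      show "norm (f y) \<le> M" if "y \<in> ball p e" "g y \<noteq> 0" for y using M that e by blast
    qed (use e dense p in auto)
    moreover have "0 < e / 16" "ball p (e/16) \<subseteq> S"
      using e subset_ball[of "e/16" e p] by auto
    ultimately show ?thesis by blast
  qed
  then obtain c d C e where est: "\<And>p. p \<in> S \<Longrightarrow> g p = 0 \<Longrightarrow> 0 < e p \<and> ball p (e p) \<subseteq> S \<and>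
      (\<forall>b\<in>ball p (e p). g b \<noteq> 0 \<longrightarrow>
        norm (f b - c p - cdot (d p) (b - p)) \<le> C p * (norm (b - p))\<^sup>2)"
    by metis
  define h where "h y = (if g y = 0 then c y else f y)" for y
  have gcont: "continuous_on S g" using g by (rule holo_on_continuous_on)
  have "\<exists>d. has_cgrad h d p" if p: "p \<in> S" for p
  proof (cases "g p = 0")
    case False
    have "open (S \<inter> g -` (- {0}))" using gcont S by (intro continuous_open_preimage) auto
    then have "open (S \<inter> {y. g y \<noteq> 0})" by (simp add: vimage_def)
    moreover obtain d where "has_cgrad f d p" using f p False by (auto simp: holo_on_iff)
    ultimately show ?thesis
      using has_cgrad_transform[of f _ p "S \<inter> {y. g y \<noteq> 0}" h] p False by (auto simp: h_def)
  next
    case True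
    note E = est[OF p True]
    \<comment> \<open>Differentiability of \<open>h\<close> at \<open>p\<close> also tests points
      \<open>b\<close> on the zero set, where \<open>h b = c b\<close> was chosen from an estimate
      at \<open>b\<close> without reference to \<open>p\<close>. Approaching \<open>b\<close> off
      the zero set, that estimate makes \<open>f (a n)\<close> tend to \<open>c b\<close>, and the
      estimate at \<open>p\<close> passes to the limit.\<close>
    have bound: "norm (h b - c p - cdot (d p) (b - p)) \<le> C p * (norm (b - p))\<^sup>2"
      if b: "b \<in> ball p (e p)" for b
    proof (cases "g b = 0")
      case gb: True
      have bS: "b \<in> S" using E b by blast
      note Eb = est[OF bS gb]
      have "\<forall>n. \<exists>a. a \<in> ball b (1 / Suc n) \<and> g a \<noteq> 0"
        using dense[OF bS] by (metis divide_pos_pos of_nat_0_less_iff zero_less_Suc zero_less_one)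
      then obtain a where a: "\<And>n. a n \<in> ball b (1 / Suc n)" "\<And>n. g (a n) \<noteq> 0" by metis
      have "(\<lambda>n. dist (a n) b) \<longlonglongrightarrow> 0"
        by (rule tendsto_sandwich[OF _ _ tendsto_const LIMSEQ_inverse_real_of_nat])
          (use a in \<open>auto simp: dist_commute inverse_eq_divide less_imp_le\<close>)
      then have lim: "a \<longlonglongrightarrow> b" by (rule tendsto_dist_iff[THEN iffD2])
      have ev1: "\<forall>\<^sub>F n in sequentially. a n \<in> ball p (e p)"
        using topological_tendstoD[OF lim open_ball b] .
      have ev2: "\<forall>\<^sub>F n in sequentially. a n \<in> ball b (e b)"
        using topological_tendstoD[OF lim open_ball] Eb by simp
      have "(\<lambda>n. f (a n)) \<longlonglongrightarrow> c b"
      proof -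
        have "(\<lambda>n. f (a n) - c b - cdot (d b) (a n - b)) \<longlonglongrightarrow> 0"
        proof (rule Lim_null_comparison)
          show "\<forall>\<^sub>F n in sequentially. norm (f (a n) - c b - cdot (d b) (a n - b)) \<le> C b * (norm (a n - b))\<^sup>2"
            using ev2 by eventually_elim (use Eb a in blast)
          show "(\<lambda>n. C b * (norm (a n - b))\<^sup>2) \<longlonglongrightarrow> 0"
            by (rule tendsto_eq_intros lim refl | simp)+
        qed
        moreover have "(\<lambda>n. c b + cdot (d b) (a n - b)) \<longlonglongrightarrow> c b"
          by (rule tendsto_eq_intros lim refl | simp)+
        ultimately have "(\<lambda>n. f (a n) - c b - cdot (d b) (a n - b) + (c b + cdot (d b) (a n - b))) \<longlonglongrightarrow> 0 + c b"
          by (rule tendsto_add)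
        then show ?thesis by simp
      qed
      then have l1: "(\<lambda>n. norm (f (a n) - c p - cdot (d p) (a n - p))) \<longlonglongrightarrow>
          norm (c b - c p - cdot (d p) (b - p))"
        by (intro tendsto_intros lim)
      have l2: "(\<lambda>n. C p * (norm (a n - p))\<^sup>2) \<longlonglongrightarrow> C p * (norm (b - p))\<^sup>2"
        by (intro tendsto_intros lim)
      have "norm (c b - c p - cdot (d p) (b - p)) \<le> C p * (norm (b - p))\<^sup>2"
        by (rule tendsto_le[OF sequentially_bot l2 l1])
          (use ev1 in eventually_elim, use E a in blast)
      then show ?thesis using gb by (simp add: h_def)
    qed (use E b in \<open>simp add: h_def\<close>)
    have "(h has_derivative cdot (d p)) (at p)"
      unfolding has_derivative_at
    proof
      show "bounded_linear (cdot (d p))"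
        using has_cgrad_cdot[of "d p" 0] has_derivative_bounded_linear unfolding has_cgrad_def by blast
      have "(\<lambda>k. norm (h (p + k) - h p - cdot (d p) k) / norm k) \<midarrow>0\<rightarrow> 0"
      proof (rule Lim_null_comparison)
        have "\<forall>\<^sub>F k in at 0. k \<in> ball (0 :: complex^'n) (e p) - {0}"
          using E by (intro eventually_at_in_open) auto
        then show "\<forall>\<^sub>F k in at 0. norm (norm (h (p + k) - h p - cdot (d p) k) / norm k) \<le> C p * norm k"
        proof eventually_elim
          case (elim k)
          then have "norm (h (p + k) - h p - cdot (d p) k) \<le> C p * (norm k)\<^sup>2"
            using bound[of "p + k"] True by (simp add: h_def dist_norm)
          then show ?case using elim by (simp add: divide_le_eq power2_eq_square mult.assoc)
        qed
        show "((\<lambda>k. C p * norm k) \<longlongrightarrow> 0) (at (0 :: complex^'n))"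
          by (rule tendsto_eq_intros refl | simp)+
      qed
      then show "(\<lambda>k. norm (h (p + k) - h p - cdot (d p) k) / norm k) \<midarrow>0\<rightarrow> 0" .
    qed
    then show ?thesis by (auto simp: has_cgrad_def)
  qed
  then have "holo_on h S" by (auto simp: holo_on_iff)
  then show ?thesis by (intro exI[of _ h]) (auto simp: h_def)
qed

section \<open>Charts of projective space\<close>

lemma other_neq [simp]: "other i j \<noteq> i" "i \<noteq> other i j"
  by (cases i; simp)+

lemma other_eq_iff [simp]: "other i j = other i k \<longleftrightarrow> j = k"
  by (cases i) auto

lemma other_cases:
  obtains "m = i" | j where "m = other i j"
proof (cases "m = i")
  case False
  show thesis
  proof (cases i)
    case None
    then show ?thesis using False that(2)[of "the m"] by auto
  next
    case (Some k)
    \<comment> \<open>\<open>other (Some k)\<close> takes the value \<open>None\<close> at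
      \<open>k\<close>, so \<open>k\<close> is the index belonging to
      \<open>m = None\<close>.\<close>
    then show ?thesis using False that(2)[of "case m of None \<Rightarrow> k | Some l \<Rightarrow> l"]
      by (cases m) auto
  qed
qed (rule that)

text \<open>\<open>ins i 1 y\<close> is the representative, normalised at \<open>i\<close>, of the
  point with affine coordinates \<open>y\<close>; \<open>ins i 0 w\<close> lifts a tangent vector
  \<open>w\<close> of the chart to the cone.\<close>

definition ins :: "'n option \<Rightarrow> complex \<Rightarrow> complex^'n::finite \<Rightarrow> complex^'n option" where
  "ins i c y = (\<chi> m. if m = i then c else y $ the_inv (other i) m)"

definition del :: "'n option \<Rightarrow> complex^'n option \<Rightarrow> complex^'n::finite" where
  "del i x = (\<chi> j. x $ other i j)"

lemma ins_nth [simp]: "ins i c y $ i = c" "ins i c y $ other i j = y $ j"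
proof -
  have "inj (other i)" by (rule injI) simp
  then show "ins i c y $ other i j = y $ j" by (simp add: ins_def the_inv_f_f)
qed (simp add: ins_def)

lemma del_nth [simp]: "del i x $ j = x $ other i j"
  by (simp add: del_def)

lemma vec_option_eqI: "x $ i = y $ i \<Longrightarrow> del i x = del i y \<Longrightarrow> x = y"
  by (metis del_nth other_cases vec_eq_iff)

lemma ins_del: "ins i (x $ i) (del i x) = x"
  by (rule vec_option_eqI[of _ i]) (simp_all add: vec_eq_iff)

lemma del_ins [simp]: "del i (ins i c y) = y"
  by (simp add: vec_eq_iff)

lemma ins_add: "ins i (c + c') (y + y') = ins i c y + ins i c' y'"
  and ins_scale: "ins i (a * c) (a *s y) = a *s ins i c y"
  by (rule vec_option_eqI[of _ i]; simp add: vec_eq_iff)+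

lemma ins_zero [simp]: "ins i 0 0 = 0"
  by (rule vec_option_eqI[of _ i]) (simp_all add: vec_eq_iff)

lemma ins_zero_scale: "ins i 0 (a *s y) = a *s ins i 0 y"
  using ins_scale[of i a 0 y] by simp

lemma del_linear: "del i (x + y) = del i x + del i y" "del i (x - y) = del i x - del i y"
  "del i (c *s x) = c *s del i x"
  by (simp_all add: vec_eq_iff)

lemma ins_one_nonzero [simp]: "ins i 1 y \<noteq> 0"
  by (metis ins_nth(1) zero_index zero_neq_one)

lemma UNIV_option: "UNIV = insert i (range (other i))"
  using other_cases[of _ i] by (metis UNIV_eq_I insert_iff rangeI)

lemma sum_option_other:
  "(\<Sum>m\<in>UNIV. f m) = f i + (\<Sum>j\<in>(UNIV :: 'n::finite set). f (other i j) :: complex)"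
proof -
  have "inj (other i)" by (rule injI) simp
  then show ?thesis
    by (subst UNIV_option[of i], subst sum.insert) (auto simp: sum.reindex)
qed

lemma cdot_ins: "cdot v (ins i c y) = v $ i * c + cdot (del i v) y"
  unfolding cdot_def by (subst sum_option_other[of _ i]) simp

text \<open>Deletion is the transpose of \<open>ins i 0\<close>: it restricts a covector on the cone
  to the affine chart.\<close>

lemma cdot_del: "cdot (del i v) y = cdot v (ins i 0 y)"
  by (simp add: cdot_ins)

lemma has_cgrad_ins_cdot: "has_cgrad (\<lambda>y. cdot v (ins i c y)) (del i v) y"
  unfolding cdot_ins using has_cgrad_add[OF has_cgrad_const has_cgrad_cdot] by fastforce

lemma has_cgrad_ins: "has_cgrad (\<lambda>y. ins i c y $ m) (del i (axis m 1)) y"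
  using has_cgrad_ins_cdot[of "axis m 1"] by simp

lemma holo_on_ins: "holo_on (\<lambda>y. ins i c y $ m) S"
  using has_cgrad_ins by (rule holo_onI)

section \<open>Points of projective space and its affine charts\<close>

definition proj :: "complex^'n::finite option \<Rightarrow> 'n cproj" where
  "proj x = Abs_cproj (vec.span {x})"

lemma mem_span_singleton: "x \<in> vec.span {y} \<longleftrightarrow> (\<exists>c. x = c *s (y :: complex^'m::finite))"
  by (auto simp: vec.span_singleton)

lemma span_scale: "c \<noteq> 0 \<Longrightarrow> vec.span {c *s x} = vec.span {x :: complex^'m::finite}"
proof (intro set_eqI iffI)
  fix v assume "c \<noteq> 0" "v \<in> vec.span {x}"
  then obtain a where "v = (a / c) *s (c *s x)" by (auto simp: mem_span_singleton vector_smult_assoc)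
  then show "v \<in> vec.span {c *s x}" unfolding mem_span_singleton by blast
qed (auto simp: mem_span_singleton vector_smult_assoc)

lemma Rep_proj: "x \<noteq> 0 \<Longrightarrow> Rep_cproj (proj x) = vec.span {x}"
  unfolding proj_def by (rule Abs_cproj_inverse) blast

lemma proj_scale: "c \<noteq> 0 \<Longrightarrow> proj (c *s x) = proj x"
  by (simp add: proj_def span_scale)

lemma proj_cases: obtains x where "x \<noteq> 0" "p = proj x"
  using Rep_cproj[of p] Rep_cproj_inverse[of p] unfolding proj_def by auto

text \<open>\<open>hcoord\<close> is a choice, known up to a nonzero factor only; what follows uses
  the ratios of its entries and whether they vanish, and both are free of the factor.\<close>

lemma hcoord_proj:
  assumes "x \<noteq> 0"
  obtains c where "c \<noteq> 0" "hcoord (proj x) = c *s x"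
proof -
  have "hcoord (proj x) \<noteq> 0 \<and> hcoord (proj x) \<in> Rep_cproj (proj x)"
    unfolding hcoord_def by (rule someI[of _ x]) (use assms in \<open>simp add: Rep_proj vec.span_base\<close>)
  then show thesis using that assms by (auto simp: Rep_proj mem_span_singleton)
qed

lemma hcoord_nonzero [simp]: "hcoord p \<noteq> 0"
  by (metis hcoord_proj proj_cases vector_mul_eq_0)

abbreviation dom where "dom \<equiv> chart_dom proj_space"
abbreviation co where "co \<equiv> coord proj_space"

definition pt :: "'n option \<Rightarrow> complex^'n::finite \<Rightarrow> 'n cproj" where
  "pt i y = proj (ins i 1 y)"

lemma proj_mem_dom: "x \<noteq> 0 \<Longrightarrow> proj x \<in> dom i \<longleftrightarrow> x $ i \<noteq> 0"
  by (metis (mono_tags, lifting) atlas.select_convs(1) hcoord_proj mem_Collect_eq mult_eq_0_iff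
      proj_space_def vector_smult_component)

lemma co_proj: "x \<noteq> 0 \<Longrightarrow> co i (proj x) = inverse (x $ i) *s del i x"
  by (rule hcoord_proj[of x]) (auto simp: proj_space_def vec_eq_iff divide_simps)

lemma pt_mem_dom: "pt i y \<in> dom j \<longleftrightarrow> ins i 1 y $ j \<noteq> 0"
  by (simp add: pt_def proj_mem_dom)

lemma pt_in_dom [simp]: "pt i y \<in> dom i"
  by (simp add: pt_mem_dom)

lemma co_pt [simp]: "co i (pt i y) = y"
  by (simp add: pt_def co_proj)

lemma pt_co: "p \<in> dom i \<Longrightarrow> pt i (co i p) = p"
proof (rule proj_cases[of p])
  fix x assume p: "p \<in> dom i" and x: "x \<noteq> 0" "p = proj x"
  then have "x $ i \<noteq> 0" by (simp add: proj_mem_dom)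
  then have "ins i 1 (co i p) = inverse (x $ i) *s x"
    using x by (intro vec_option_eqI[of _ i]) (simp_all add: co_proj del_linear)
  then show ?thesis using \<open>x $ i \<noteq> 0\<close> x by (simp add: pt_def proj_scale)
qed

text \<open>Each chart maps onto the whole of \<open>complex^'n\<close>, so its inverse
  \<open>pt i\<close> is total; this is what lets chart images be written as
  \<open>{y. pt i y \<in> U}\<close>.\<close>

lemma param_eq: "param proj_space i y = pt i y"
proof -
  have "inj_on (co i) (dom i)" by (rule inj_on_inverseI[of _ "pt i"]) (simp add: pt_co)
  then show ?thesis unfolding param_def by (rule the_inv_into_f_eq) simp_all
qed

lemma co_image: "co i ` (U \<inter> dom i) = {y. pt i y \<in> U}"
  by (force simp: pt_co image_iff intro: bexI[of _ "pt i _"])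

lemma co_pt_other: "pt j y \<in> dom i \<Longrightarrow> co i (pt j y) = inverse (ins j 1 y $ i) *s del i (ins j 1 y)"
  unfolding pt_def by (rule co_proj) simp

lemma mopen_iff: "mopen proj_space U \<longleftrightarrow> (\<forall>i. open {y. pt i y \<in> U})"
  by (simp add: mopen_def co_image)

lemma mholo_on_iff: "mholo_on proj_space f U \<longleftrightarrow> (\<forall>i. holo_on (\<lambda>y. f (pt i y)) {y. pt i y \<in> U})"
  by (simp add: mholo_on_def co_image o_def param_eq)

lemma open_pt_dom: "open {y. pt j y \<in> dom i}"
  unfolding pt_mem_dom using holo_on_continuous_on[OF holo_on_ins[of j 1 i UNIV]]
  by (intro open_Collect_neq) auto

lemma holo_on_transition: "holo_on (\<lambda>y. co i (pt j y) $ k) {y. pt j y \<in> dom i}"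
proof (rule holo_on_transform[OF _ open_pt_dom])
  show "holo_on (\<lambda>y. inverse (ins j 1 y $ i) * ins j 1 y $ other i k) {y. pt j y \<in> dom i}"
    by (intro holo_on_mult holo_on_inverse holo_on_ins) (simp add: pt_mem_dom)
qed (simp add: co_pt_other)

lemma continuous_on_transition: "continuous_on {y. pt j y \<in> dom i} (\<lambda>y. co i (pt j y))"
  using continuous_on_vec_lambda[where f = "\<lambda>k y. co i (pt j y) $ k", OF holo_on_continuous_on[OF holo_on_transition]]
  by simp

lemma mopen_pt_image: assumes "open S" shows "mopen proj_space (pt i ` S)"
  unfolding mopen_iff
proof
  fix j
  have "{y. pt j y \<in> pt i ` S} = {y. pt j y \<in> dom i} \<inter> (\<lambda>y. co i (pt j y)) -` S"
    by (auto simp: image_iff) (metis pt_co)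
  then show "open {y. pt j y \<in> pt i ` S}"
    using continuous_open_preimage[OF continuous_on_transition open_pt_dom assms] by simp
qed

text \<open>\<open>mholo_on\<close> quantifies over all charts; inside \<open>dom i\<close> the
  others follow by composing with the holomorphic transition to chart \<open>i\<close>.\<close>

lemma mholo_on_chart:
  assumes "holo_on (\<lambda>y. f (pt i y)) {y. pt i y \<in> U}"
  shows "mholo_on proj_space f (U \<inter> dom i)"
  unfolding mholo_on_iff
proof
  fix j
  have "holo_on (\<lambda>y. f (pt i (co i (pt j y)))) {y. pt j y \<in> U \<inter> dom i}"
    by (rule holo_on_compose[OF assms holo_on_subset[OF holo_on_transition]]) (auto simp: pt_co)
  then show "holo_on (\<lambda>y. f (pt j y)) {y. pt j y \<in> U \<inter> dom i}"
    unfolding holo_on_iff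
    using has_cgrad_transform[OF _ open_pt_dom[of j i], of "\<lambda>y. f (pt i (co i (pt j y)))" _ _ "\<lambda>y. f (pt j y)"]
    by simp (metis pt_co)
qed

lemma mholo_on_chart_iff:
  "mholo_on proj_space f (U \<inter> dom i) \<longleftrightarrow> holo_on (\<lambda>y. f (pt i y)) {y. pt i y \<in> U}"
proof
  assume "mholo_on proj_space f (U \<inter> dom i)"
  then have "holo_on (\<lambda>y. f (pt i y)) {y. pt i y \<in> U \<inter> dom i}" unfolding mholo_on_iff by blast
  then show "holo_on (\<lambda>y. f (pt i y)) {y. pt i y \<in> U}" by simp
qed (rule mholo_on_chart)

section \<open>Transition matrices of the tangent bundle, its twist and its dual\<close>

lemma differential_eq: "differential proj_space f i p = cgrad (\<lambda>y. f (pt i y)) (co i p)"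
  by (simp add: differential_def cgrad_def o_def param_eq)

text \<open>\<open>matrix\<close> reads a derivative off its values on the axes; since the
  transition is holomorphic, the rows obtained are complex gradients, in the form that
  \<open>has_cgrad_compose\<close> accepts.\<close>

lemma transition_cgrad:
  assumes "p \<in> dom i" "p \<in> dom j"
  shows "has_cgrad (\<lambda>y. co i (pt j y) $ k) (tangent_bundle proj_space i j p $ k) (co j p)"
proof -
  let ?g = "\<lambda>k. cgrad (\<lambda>y. co i (pt j y) $ k) (co j p)"
  have c: "has_cgrad (\<lambda>y. co i (pt j y) $ k) (?g k) (co j p)" for k
    using holo_on_transition by (rule holo_on_cgrad) (simp add: pt_co assms)
  have "((\<lambda>y. co i (pt j y)) has_derivative (\<lambda>h. \<chi> k. cdot (?g k) h)) (at (co j p))"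
    by (rule has_derivative_vecI) (use c in \<open>simp add: has_cgrad_def\<close>)
  then have "frechet_derivative (co i \<circ> param proj_space j) (at (co j p)) = (\<lambda>h. \<chi> k. cdot (?g k) h)"
    by (simp add: o_def param_eq frechet_derivative_at[symmetric])
  then have "tangent_bundle proj_space i j p $ k = ?g k"
    by (simp add: tangent_bundle_def matrix_def vec_eq_iff)
  with c show ?thesis by simp
qed

text \<open>The derivative of \<open>x\<^sub>m / x\<^sub>i\<close> in the direction \<open>W\<close> is \<open>(W\<^sub>m x\<^sub>i - x\<^sub>m W\<^sub>i) / x\<^sub>i\<^sup>2\<close>.\<close>

lemma tangent_bundle_mult:
  assumes p: "p \<in> dom i" "p \<in> dom j"
  defines "X \<equiv> ins j 1 (co j p)"
  shows "tangent_bundle proj_space i j p *v w =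
    inverse ((X $ i)\<^sup>2) *s del i (X $ i *s ins j 0 w - ins j 0 w $ i *s X)"
proof -
  have Xi: "X $ i \<noteq> 0" using p pt_mem_dom[of j "co j p" i] by (simp add: pt_co X_def)
  have "cdot (tangent_bundle proj_space i j p $ k) w =
      inverse ((X $ i)\<^sup>2) * (X $ i * ins j 0 w $ other i k - ins j 0 w $ i * X $ other i k)" for k
  proof -
    have "has_cgrad (\<lambda>y. inverse (ins j 1 y $ i) * ins j 1 y $ other i k)
      (inverse (X $ i) *s del j (axis (other i k) 1) +
       X $ other i k *s (- inverse (X $ i ^ 2) *s del j (axis i 1))) (co j p)"
      unfolding X_def by (intro has_cgrad_mult has_cgrad_inverse has_cgrad_ins) (use Xi X_def in simp)
    then have "has_cgrad (\<lambda>y. co i (pt j y) $ k)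
      (inverse (X $ i) *s del j (axis (other i k) 1) +
       X $ other i k *s (- inverse (X $ i ^ 2) *s del j (axis i 1))) (co j p)"
      by (rule has_cgrad_transform[OF _ open_pt_dom[of j i]]) (auto simp: pt_co p co_pt_other)
    then have T: "tangent_bundle proj_space i j p $ k = inverse (X $ i) *s del j (axis (other i k) 1) +
       X $ other i k *s (- inverse (X $ i ^ 2) *s del j (axis i 1))"
      using transition_cgrad[OF p] by (metis cgrad_eq)
    then show ?thesis
      unfolding T using Xi by (simp add: cdot_simps cdot_del field_simps power2_eq_square)
  qed
  then show ?thesis by (simp add: matrix_vector_mult_def vec_eq_iff cdot_def)
qed

lemma hcoord_pt_ratio: "hcoord (pt j y) $ m * ins j 1 y $ l = hcoord (pt j y) $ l * ins j 1 y $ m"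
  by (metis (no_types, lifting) hcoord_proj ins_one_nonzero mult.assoc mult.commute pt_def
      vector_smult_component)

lemma mat_mul_vec: "(mat c ** A) *v w = c *s (A *v (w :: complex^'n::finite))"
  by (simp add: mat_def matrix_vector_mul_assoc[symmetric])
     (simp add: matrix_vector_mult_def vec_eq_iff if_distrib[of "\<lambda>x. x * _"] cong: if_cong)

abbreviation "TM2 \<equiv> tensor_line (tangent_bundle proj_space) (proj_O (-2))"

text \<open>The twist contributes \<open>(X $ i)\<^sup>2\<close>, exactly the denominator in
  \<open>tangent_bundle_mult\<close>, so the cocycle is polynomial in the coordinates. Its value is
  the lift of \<open>w\<close>, scaled by \<open>X $ i\<close> and moved along \<open>X\<close>
  until entry \<open>i\<close> vanishes.\<close>

lemma TM2_mult:
  assumes p: "p \<in> dom i" "p \<in> dom j"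
  defines "X \<equiv> ins j 1 (co j p)"
  shows "TM2 i j p *v w = del i (X $ i *s ins j 0 w - ins j 0 w $ i *s X)"
proof -
  have Xi: "X $ i \<noteq> 0" using p pt_mem_dom[of j "co j p" i] by (simp add: pt_co X_def)
  have h: "hcoord p $ i \<noteq> 0" "hcoord p $ j \<noteq> 0" using p by (auto simp: proj_space_def)
  have "hcoord p $ i = hcoord p $ j * X $ i"
    using hcoord_pt_ratio[of j "co j p" i j] p by (simp add: pt_co X_def)
  then have "proj_O (- 2) i j p = (X $ i)\<^sup>2"
    using h Xi by (simp add: proj_O_def power_int_def field_simps)
  then show ?thesis
    using Xi by (simp add: tensor_line_def mat_mul_vec tangent_bundle_mult[OF p] X_def
        vector_smult_assoc)
qed

lemma cdot_transpose: "cdot (transpose A *v u) w = cdot u (A *v w)"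
  unfolding cdot_def matrix_vector_mult_def transpose_def
  by (simp add: sum_distrib_left sum_distrib_right mult_ac) (rule sum.swap)

lemma dual_tangent_mult:
  assumes p: "p \<in> dom i" "p \<in> dom j"
  shows "dual_bundle (tangent_bundle proj_space) i j p *v u =
    (\<Sum>k\<in>UNIV. u $ k *s tangent_bundle proj_space j i p $ k)"
  by (simp add: dual_bundle_def matrix_vector_mult_def transpose_def vec_eq_iff mult.commute)

text \<open>By the chain rule, differentials transform by the transposed Jacobian, which is the
  cocycle of \<open>dual_bundle\<close>.\<close>

lemma differential_transition:
  assumes p: "p \<in> dom i" "p \<in> dom j"
    and d: "has_cgrad (\<lambda>y. f (pt j y)) d (co j p)"
  shows "differential proj_space f i p =
    dual_bundle (tangent_bundle proj_space) i j p *v differential proj_space f j p"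
proof -
  have "has_cgrad (\<lambda>y. f (pt j (co j (pt i y)))) (\<Sum>k\<in>UNIV. d $ k *s tangent_bundle proj_space j i p $ k)
      (co i p)"
    by (rule has_cgrad_compose[OF _ transition_cgrad]) (use p d in \<open>simp_all add: pt_co\<close>)
  then have "has_cgrad (\<lambda>y. f (pt i y)) (\<Sum>k\<in>UNIV. d $ k *s tangent_bundle proj_space j i p $ k) (co i p)"
    by (rule has_cgrad_transform[OF _ open_pt_dom[of i j]]) (auto simp: pt_co p)
  then show ?thesis
    using cgrad_eq[OF d] by (simp add: differential_eq dual_tangent_mult[OF p] cgrad_eq)
qed

section \<open>The quadric and its polarity\<close>

lemma matrix_vector_sum: "A *v (\<Sum>k\<in>I. f k) = (\<Sum>k\<in>I. A *v (f k :: complex^'n::finite))"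
  by (induction I rule: infinite_finite_induct) (simp_all add: matrix_vector_right_distrib)

lemma matrix_vector_nth: "(A *v x) $ m = cdot (A $ m) x"
  by (simp add: matrix_vector_mult_def cdot_def)

lemma matrix_vector_scale: "A *v (c *s x) = c *s (A *v (x :: complex^'n::finite))"
  by (simp add: vec_eq_iff matrix_vector_nth cdot_simps)

lemmas matrix_vector_simps = matrix_vector_right_distrib matrix_vector_mult_diff_distrib
  matrix_vector_scale

lemma holo_on_matrix:
  "(\<And>k. holo_on (\<lambda>y. g y $ k) S) \<Longrightarrow> holo_on (\<lambda>y. (A *v g y) $ m) S"
  unfolding matrix_vector_nth by (intro holo_on_cdot holo_on_const)

lemma holo_on_ins_compose:
  assumes "holo_on c S" "\<And>k. holo_on (\<lambda>y. w y $ k) S"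
  shows "holo_on (\<lambda>y. ins i (c y) (w y) $ m) S"
  using assms by (cases m i rule: other_cases) simp_all

text \<open>Smoothness of the quadric is carried by the inverse \<open>B\<close> of its symmetric
  matrix: it supplies both the nonvanishing gradient on \<open>Q\<close> and the inverse
  polarity.\<close>

locale quadric =
  fixes A B :: "complex^'n::finite option^'n option" and Q :: "'n cproj set"
  assumes sym: "transpose A = A" and AB: "A ** B = mat 1" and BA: "B ** A = mat 1"
    and Q: "\<And>x. x \<noteq> 0 \<Longrightarrow> proj x \<in> Q \<longleftrightarrow> cdot x (A *v x) = 0"
begin

definition bil where "bil v w = cdot v (A *v w)"

definition q :: "'n option \<Rightarrow> complex^'n \<Rightarrow> complex" where
  "q i y = bil (ins i 1 y) (ins i 1 y)"

lemma bil_commute: "bil v w = bil w v"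
  unfolding bil_def by (metis cdot_commute cdot_transpose sym)

lemma bil_simps: "bil (u + v) w = bil u w + bil v w" "bil w (u + v) = bil w u + bil w v"
  "bil (u - v) w = bil u w - bil v w" "bil w (u - v) = bil w u - bil w v"
  "bil (c *s u) w = c * bil u w" "bil w (c *s u) = c * bil w u"
  by (simp_all add: bil_def matrix_vector_simps cdot_simps)

lemma A_B [simp]: "A *v (B *v x) = x" and B_A [simp]: "B *v (A *v x) = x"
  by (simp_all add: matrix_vector_mul_assoc AB BA)

lemma A_eq_0: "A *v x = 0 \<Longrightarrow> x = 0"
  by (metis B_A matrix_vector_mult_0_right)

lemma pt_mem_Q: "pt i y \<in> Q \<longleftrightarrow> q i y = 0"
  by (simp add: pt_def Q q_def bil_def)

lemma mem_Q: "p \<in> dom i \<Longrightarrow> p \<in> Q \<longleftrightarrow> q i (co i p) = 0"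
  by (metis pt_co pt_mem_Q)

definition dq :: "'n option \<Rightarrow> complex^'n \<Rightarrow> complex^'n" where
  "dq i y = 2 *s del i (A *v ins i 1 y)"

text \<open>The product rule yields two terms that are equal by the symmetry of \<open>A\<close>,
  hence the factor 2 in \<open>dq\<close>.\<close>

lemma has_cgrad_q: "has_cgrad (q i) (dq i y) y"
proof -
  have 1: "has_cgrad (\<lambda>y. (A *v ins i 1 y) $ m) (del i (A $ m)) y" for m
    unfolding matrix_vector_nth by (rule has_cgrad_ins_cdot)
  have "has_cgrad (q i) (\<Sum>m\<in>UNIV. ins i 1 y $ m *s del i (A $ m) + (A *v ins i 1 y) $ m *s del i (axis m 1)) y"
    unfolding q_def[abs_def] bil_def cdot_def
    by (intro has_cgrad_sum has_cgrad_mult 1 has_cgrad_ins)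
  moreover have "(\<Sum>m\<in>UNIV. ins i 1 y $ m *s del i (A $ m) + (A *v ins i 1 y) $ m *s del i (axis m 1)) = dq i y"
  proof (rule cdot_eqI)
    fix w
    have "cdot (\<Sum>m\<in>UNIV. ins i 1 y $ m *s del i (A $ m) + (A *v ins i 1 y) $ m *s del i (axis m 1)) w
        = (\<Sum>m\<in>UNIV. ins i 1 y $ m * (A *v ins i 0 w) $ m) + (\<Sum>m\<in>UNIV. (A *v ins i 1 y) $ m * ins i 0 w $ m)"
      by (simp add: cdot_sum_left cdot_simps cdot_del matrix_vector_nth sum.distrib)
    also have "\<dots> = bil (ins i 1 y) (ins i 0 w) + bil (ins i 0 w) (ins i 1 y)"
      by (simp add: bil_def cdot_def mult.commute)
    also have "\<dots> = cdot (dq i y) w"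
      by (simp add: bil_commute[of "ins i 1 y"] dq_def cdot_simps cdot_del)
        (simp add: bil_def cdot_commute)
    finally show "cdot (\<Sum>m\<in>UNIV. ins i 1 y $ m *s del i (A $ m) + (A *v ins i 1 y) $ m *s del i (axis m 1)) w = cdot (dq i y) w" .
  qed
  ultimately show ?thesis by simp
qed

lemma holo_on_q: "holo_on (q i) S"
  using has_cgrad_q by (rule holo_onI)

lemma isCont_q: "isCont (q i) y"
  using has_cgrad_q by (rule has_cgrad_continuous)

lemma holo_on_dq: "holo_on (\<lambda>y. dq i y $ k) S"
  unfolding dq_def by (simp, intro holo_on_mult holo_on_const holo_on_matrix holo_on_ins)

lemma open_not_Q: "open S \<Longrightarrow> open (S \<inter> {y. q i y \<noteq> 0})"
  using isCont_q by (intro open_Int open_Collect_neq) (auto intro: continuous_at_imp_continuous_on)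

text \<open>With \<open>x = ins i 1 y\<close>, Euler's relation expresses \<open>q\<close> by entry
  \<open>i\<close> of \<open>A x\<close> and the remaining entries. If \<open>q\<close> and the
  chart gradient vanish, then so does entry \<open>i\<close>, hence \<open>A x = 0\<close>, against
  the invertibility of \<open>A\<close>.\<close>

lemma dq_nonzero:
  assumes "q i y = 0" shows "dq i y \<noteq> 0"
proof
  assume "dq i y = 0"
  then have d: "del i (A *v ins i 1 y) = 0" by (simp add: dq_def)
  have "q i y = (A *v ins i 1 y) $ i + cdot (del i (A *v ins i 1 y)) y"
    unfolding q_def bil_def by (subst cdot_commute) (simp add: cdot_ins)
  then have "(A *v ins i 1 y) $ i = 0" using d assms by simp
  then have "A *v ins i 1 y = 0" using d by (intro vec_option_eqI[of _ i]) (simp_all add: vec_eq_iff)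
  then show False using A_eq_0 ins_one_nonzero by blast
qed

text \<open>If \<open>q\<close> vanished on a ball, its centre would be a point of the quadric with
  zero gradient.\<close>

lemma q_dense: "0 < r \<Longrightarrow> \<exists>a\<in>ball y r. q i a \<noteq> 0"
proof (rule ccontr)
  assume r: "0 < r" and "\<not> (\<exists>a\<in>ball y r. q i a \<noteq> 0)"
  then have z: "\<And>a. a \<in> ball y r \<Longrightarrow> q i a = 0" by blast
  have "has_cgrad (q i) 0 y"
    using r by (intro has_cgrad_transform[OF has_cgrad_const, of "ball y r" y 0]) (auto simp: z)
  then have "dq i y = 0" using has_cgrad_q cgrad_eq by metis
  then show False using dq_nonzero z[of y] r by simp
qed

text \<open>Transfers identities known off the quadric to the quadric itself; injectivity and the
  cocycle condition are obtained this way.\<close>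

lemma eq_off_Q_imp_eq:
  fixes f g :: "complex^'n \<Rightarrow> complex"
  assumes "isCont f y" "isCont g y" "open S" "y \<in> S" "\<And>w. w \<in> S \<Longrightarrow> q i w \<noteq> 0 \<Longrightarrow> f w = g w"
  shows "f y = g y"
proof (rule ccontr)
  assume ne: "f y \<noteq> g y"
  have "isCont (\<lambda>w. f w - g w) y" using assms by (intro continuous_intros)
  then have "((\<lambda>w. f w - g w) \<longlongrightarrow> f y - g y) (nhds y)"
    unfolding isCont_def by (rule tendsto_at_iff_tendsto_nhds[THEN iffD1])
  then have "\<forall>\<^sub>F w in nhds y. f w - g w \<noteq> 0"
    by (rule tendsto_imp_eventually_ne) (use ne in simp)
  moreover have "\<forall>\<^sub>F w in nhds y. w \<in> S" using assms by (simp add: eventually_nhds_in_open)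
  ultimately have "\<forall>\<^sub>F w in nhds y. f w - g w \<noteq> 0 \<and> w \<in> S" by (rule eventually_conj)
  then obtain r where "r > 0" "\<And>w. dist w y < r \<Longrightarrow> f w - g w \<noteq> 0 \<and> w \<in> S"
    unfolding eventually_nhds_metric by blast
  then show False using q_dense[of r y i] assms(5) by (metis dist_commute eq_iff_diff_eq_0 mem_ball)
qed

text \<open>The form \<open>H x\<close> has \<open>x\<close> in its kernel, so it descends to the tangent space at \<open>[x]\<close>; it is
  nondegenerate there off the quadric.\<close>

definition H where "H x v w = bil v w - bil x v * bil x w / bil x x"

lemma H_simps: "H x (u + v) w = H x u w + H x v w" "H x w (u + v) = H x w u + H x w v"
  "H x (u - v) w = H x u w - H x v w" "H x w (u - v) = H x w u - H x w v"
  "H x (c *s u) w = c * H x u w" "H x w (c *s u) = c * H x w u"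
  by (simp_all add: H_def bil_simps algebra_simps add_divide_distrib diff_divide_distrib)

lemma H_self: "bil x x \<noteq> 0 \<Longrightarrow> H x x v = 0" "bil x x \<noteq> 0 \<Longrightarrow> H x v x = 0"
  by (simp_all add: H_def bil_commute)

lemma H_scale: "c \<noteq> 0 \<Longrightarrow> H (c *s x) = H x"
  by (simp add: H_def fun_eq_iff bil_simps)

definition phi :: "'n option \<Rightarrow> complex^'n \<Rightarrow> complex^'n \<Rightarrow> complex^'n" where
  "phi i y s = del i (A *v ins i 0 s) - (bil (ins i 1 y) (ins i 0 s) / q i y) *s del i (A *v ins i 1 y)"

text \<open>Expresses the chart formula by the form \<open>H\<close> on the cone, where bilinearity,
  scaling in \<open>x\<close> and the kernel make linearity and change of chart short
  computations.\<close>

lemma cdot_phi: "cdot (phi i y s) w = H (ins i 1 y) (ins i 0 w) (ins i 0 s)"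
proof -
  have "cdot (A *v v) w = bil w v" for v w by (simp add: bil_def cdot_commute)
  then show ?thesis
    by (simp add: phi_def cdot_simps cdot_del H_def q_def) (simp add: bil_commute[of "ins i 0 w" "ins i 1 y"])
qed

text \<open>The representatives \<open>X\<close> and \<open>Y\<close> of \<open>p\<close> are
  proportional and have equal \<open>H\<close>. The lifts of the transformed vectors are scaled old
  lifts up to multiples of that representative, which \<open>H\<close> kills. The scalings agree:
  the twisted field contributes \<open>Y $ i\<close>, the transposed Jacobian contributes
  \<open>1 / X $ j\<close>, and these are equal because \<open>X\<close> is \<open>Y\<close> divided
  by \<open>Y $ i\<close>.\<close>

lemma phi_transition:
  assumes p: "p \<in> dom i" "p \<in> dom j" "p \<notin> Q"
  shows "phi i (co i p) (TM2 i j p *v s) =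
    dual_bundle (tangent_bundle proj_space) i j p *v phi j (co j p) s"
proof (rule cdot_eqI)
  fix w
  let ?X = "ins i 1 (co i p)" and ?Y = "ins j 1 (co j p)"
  have Yi: "?Y $ i \<noteq> 0" using p pt_mem_dom[of j "co j p" i] by (simp add: pt_co)
  have "co i p = inverse (?Y $ i) *s del i ?Y" using co_pt_other[of j "co j p" i] p by (simp add: pt_co)
  then have XY: "?X = inverse (?Y $ i) *s ?Y"
    using Yi by (intro vec_option_eqI[of _ i]) (simp_all add: del_linear)
  then have Xj: "?X $ j = inverse (?Y $ i)" by simp
  have H: "H ?X = H ?Y" using Yi XY H_scale by simp
  have qX: "bil ?X ?X \<noteq> 0" and qY: "bil ?Y ?Y \<noteq> 0" using p mem_Q by (auto simp: q_def)
  have i0: "ins i 0 (TM2 i j p *v s) = ?Y $ i *s ins j 0 s - ins j 0 s $ i *s ?Y"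
    unfolding TM2_mult[OF p(1,2)] by (rule vec_option_eqI[of _ i]) simp_all
  have j0: "ins j 0 (tangent_bundle proj_space j i p *v w) =
      inverse ((?X $ j)\<^sup>2) *s (?X $ j *s ins i 0 w - ins i 0 w $ j *s ?X)"
    unfolding tangent_bundle_mult[OF p(2,1)] by (rule vec_option_eqI[of _ j]) (simp_all add: del_linear)
  have "cdot (phi i (co i p) (TM2 i j p *v s)) w = ?Y $ i * H ?Y (ins i 0 w) (ins j 0 s)"
    unfolding cdot_phi i0 H using qY by (simp add: H_simps H_self)
  also have "\<dots> = H ?Y (ins j 0 (tangent_bundle proj_space j i p *v w)) (ins j 0 s)"
    unfolding j0 H[symmetric] using qX Yi by (simp add: H_simps H_self Xj power2_eq_square)
  also have "\<dots> = cdot (dual_bundle (tangent_bundle proj_space) i j p *v phi j (co j p) s) w"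
    unfolding dual_bundle_def cdot_transpose cdot_phi ..
  finally show "cdot (phi i (co i p) (TM2 i j p *v s)) w =
    cdot (dual_bundle (tangent_bundle proj_space) i j p *v phi j (co j p) s) w" .
qed

text \<open>A form \<open>w\<close> in chart \<open>i\<close> lifts to the covector \<open>ins i (- cdot w y) w\<close> on the cone, the one that
  kills \<open>x = ins i 1 y\<close>; \<open>nn\<close> applies the inverse polarity and projects along \<open>x\<close> to the chart.\<close>

definition nn :: "'n option \<Rightarrow> complex^'n \<Rightarrow> complex^'n option \<Rightarrow> complex^'n" where
  "nn i y g = del i (B *v g) - (B *v g) $ i *s y"

definition psi :: "'n option \<Rightarrow> complex^'n \<Rightarrow> complex^'n \<Rightarrow> complex^'n" where
  "psi i y w = nn i y (ins i (- cdot w y) w)"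

lemma nn_linear: "nn i y (g + g') = nn i y g + nn i y g'" "nn i y (g - g') = nn i y g - nn i y g'"
  "nn i y (c *s g) = c *s nn i y g"
  by (simp_all add: nn_def matrix_vector_simps vec_eq_iff algebra_simps)

lemma psi_linear: "psi i y (w + w') = psi i y w + psi i y w'" "psi i y (c *s w) = c *s psi i y w"
  "psi i y 0 = 0"
proof -
  have "ins i (- cdot (w + w') y) (w + w') = ins i (- cdot w y) w + ins i (- cdot w' y) w'"
    by (simp add: cdot_simps flip: ins_add)
  then show "psi i y (w + w') = psi i y w + psi i y w'" by (simp add: psi_def nn_linear)
  have c: "ins i (- cdot (c *s w) y) (c *s w) = c *s ins i (- cdot w y) w" for c w
    by (simp add: cdot_simps flip: ins_scale)
  then show "psi i y (c *s w) = c *s psi i y w" by (simp add: psi_def nn_linear)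
  show "psi i y 0 = 0" by (simp add: psi_def nn_def vec_eq_iff)
qed

lemma psi_sum: "psi i y (\<Sum>k\<in>I. f k) = (\<Sum>k\<in>I. psi i y (f k))"
  by (induction I rule: infinite_finite_induct) (simp_all add: psi_linear)

text \<open>The covector \<open>A v - b A x\<close> with \<open>v = ins i 0 s\<close> kills
  \<open>x\<close>, so \<open>psi\<close> rebuilds it from its restriction to the chart.
  \<open>B\<close> maps it to \<open>v - b x\<close>, and projecting along \<open>x\<close> leaves
  \<open>s\<close>.\<close>

lemma psi_phi:
  assumes "q i y \<noteq> 0" shows "psi i y (phi i y s) = s"
proof -
  let ?X = "ins i 1 y" and ?b = "bil (ins i 1 y) (ins i 0 s) / q i y"
  let ?g = "A *v ins i 0 s - ?b *s (A *v ?X)"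
  have del: "del i ?g = phi i y s" by (simp add: phi_def del_linear)
  have "cdot ?g ?X = bil ?X (ins i 0 s) - ?b * q i y"
    by (simp add: cdot_simps q_def bil_def cdot_commute)
  then have "cdot ?g ?X = 0" using assms by simp
  then have "?g $ i = - cdot (phi i y s) y" unfolding cdot_ins del by (simp add: eq_neg_iff_add_eq_0)
  then have "ins i (- cdot (phi i y s) y) (phi i y s) = ?g" using del ins_del by metis
  moreover have "B *v ?g = ins i 0 s - ?b *s ?X" by (simp add: matrix_vector_simps)
  ultimately show ?thesis unfolding psi_def nn_def by (simp only:) (simp add: vec_eq_iff)
qed

text \<open>With \<open>g\<close> the lift of \<open>w\<close>, projection to the chart removes
  \<open>c\<close> times \<open>x\<close> from \<open>B g\<close>. Since \<open>g\<close> kills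
  \<open>x\<close>, the correction term in \<open>phi\<close> restores precisely \<open>c\<close>
  times \<open>A x\<close>.\<close>

lemma phi_psi:
  assumes "q i y \<noteq> 0" shows "phi i y (psi i y w) = w"
proof -
  let ?X = "ins i 1 y" and ?g = "ins i (- cdot w y) w"
  define c where "c = (B *v ?g) $ i"
  have e: "ins i 0 (psi i y w) = B *v ?g - c *s ?X"
    by (rule vec_option_eqI[of _ i]) (simp_all add: psi_def nn_def del_linear c_def)
  then have Ae: "A *v ins i 0 (psi i y w) = ?g - c *s (A *v ?X)" by (simp add: matrix_vector_simps)
  have "cdot ?g ?X = 0" by (simp add: cdot_ins)
  then have "bil ?X (ins i 0 (psi i y w)) = - c * q i y"
    unfolding bil_def Ae by (simp add: cdot_simps q_def bil_def cdot_commute)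
  then show ?thesis using assms unfolding phi_def Ae by (simp add: del_linear vec_eq_iff)
qed

text \<open>The form \<open>dq\<close> extends \<open>A x\<close>, which the polarity maps to the Euler direction, hence to zero.\<close>

lemma psi_dq: "psi i y (dq i y) = (- 2 * q i y) *s nn i y (axis i 1)"
proof -
  let ?X = "ins i 1 y"
  have "q i y = cdot (A *v ?X) ?X" unfolding q_def bil_def by (rule cdot_commute)
  then have "q i y = (A *v ?X) $ i + cdot (del i (A *v ?X)) y" by (simp add: cdot_ins)
  then have "ins i (- cdot (dq i y) y) (dq i y) = 2 *s (A *v ?X) - (2 * q i y) *s axis i 1"
    by (intro vec_option_eqI[of _ i]) (simp_all add: dq_def cdot_simps vec_eq_iff axis_def algebra_simps)
  moreover have "nn i y (A *v ?X) = 0" by (simp add: nn_def vec_eq_iff)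
  ultimately show ?thesis unfolding psi_def by (simp only: nn_linear) (simp add: vec_eq_iff)
qed

lemma holo_on_nn:
  assumes "\<And>m. holo_on (\<lambda>y. g y $ m) S"
  shows "holo_on (\<lambda>y. nn i y (g y) $ k) S"
  unfolding nn_def by (simp, intro holo_on_diff holo_on_mult holo_on_matrix holo_on_nth assms)

lemma holo_on_psi:
  assumes "\<And>k. holo_on (\<lambda>y. w y $ k) S"
  shows "holo_on (\<lambda>y. psi i y (w y) $ k) S"
proof -
  have "holo_on (\<lambda>y. 0 - cdot (w y) y) S"
    by (intro holo_on_diff holo_on_cdot holo_on_const holo_on_nth assms)
  then show ?thesis
    unfolding psi_def by (intro holo_on_nn holo_on_ins_compose assms) simp
qed

lemma holo_on_bil:
  assumes "\<And>k. holo_on (\<lambda>y. v y $ k) S" "\<And>k. holo_on (\<lambda>y. w y $ k) S"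
  shows "holo_on (\<lambda>y. bil (v y) (w y)) S"
  unfolding bil_def by (intro holo_on_cdot holo_on_matrix assms)

lemma holo_on_phi:
  assumes "\<And>k. holo_on (\<lambda>y. s y $ k) S" "\<And>y. y \<in> S \<Longrightarrow> q i y \<noteq> 0"
  shows "holo_on (\<lambda>y. phi i y (s y) $ k) S"
  unfolding phi_def
  by (simp, intro holo_on_diff holo_on_mult holo_on_divide holo_on_matrix holo_on_bil holo_on_ins
      holo_on_ins_compose holo_on_const holo_on_q assms)

end

section \<open>Logarithmic forms near the quadric\<close>

lemma eventually_ballI:
  assumes "0 < r" "\<And>y. y \<in> ball x r \<Longrightarrow> P y"
  shows "\<forall>\<^sub>F y in nhds x. P y"
  using assms eventually_nhds_metric[of P x] by (auto simp: dist_commute)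

lemma holo_on_tendsto: "holo_on f S \<Longrightarrow> x \<in> S \<Longrightarrow> (f \<longlongrightarrow> f x) (nhds x)"
  using holo_on_isCont unfolding isCont_def by (metis tendsto_at_iff_tendsto_nhds)

lemma tendsto_locally_bounded:
  fixes f :: "'a \<Rightarrow> 'b::real_normed_vector"
  assumes "(f \<longlongrightarrow> c) F" shows "\<forall>\<^sub>F y in F. norm (f y) \<le> norm c + 1"
proof -
  have "\<forall>\<^sub>F y in F. norm (f y) < norm c + 1"
    using order_tendstoD(2)[OF tendsto_norm[OF assms]] by simp
  then show ?thesis by eventually_elim simp
qed

lemma holo_on_bounded_ball:
  assumes "holo_on f S" "open S" "x \<in> S"
  obtains R where "0 < R" "ball x R \<subseteq> S" "\<And>y. y \<in> ball x R \<Longrightarrow> norm (f y) \<le> norm (f x) + 1"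
proof -
  have "\<forall>\<^sub>F y in nhds x. norm (f y) \<le> norm (f x) + 1 \<and> y \<in> S"
    using tendsto_locally_bounded[OF holo_on_tendsto[OF assms(1,3)]] assms
    by (intro eventually_conj) (simp_all add: eventually_nhds_in_open)
  then obtain R where "R > 0" "\<And>y. dist y x < R \<Longrightarrow> norm (f y) \<le> norm (f x) + 1 \<and> y \<in> S"
    unfolding eventually_nhds_metric by blast
  then show thesis by (intro that[of R]) (auto simp: dist_commute)
qed

lemma line_in_ball:
  fixes a u p :: "complex^'n::finite"
  assumes "a \<in> ball p r" "norm u = 1" "norm t < s" "r + s \<le> e"
  shows "a + t *s u \<in> ball p e"
proof -
  have "dist p (a + t *s u) \<le> dist p a + norm (t *s u)"
    by (metis add_diff_cancel_left' dist_norm dist_triangle norm_minus_commute)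
  moreover have "norm (t *s u) = norm t" using assms(2) by (simp add: norm_vector_smult)
  ultimately show ?thesis using assms unfolding mem_ball by linarith
qed

text \<open>\<open>holo_line_estimates\<close> with the constant 1 for \<open>g\<close>, so with an
  empty exceptional set.\<close>

lemma cgrad_line_bound:
  assumes f: "holo_on f (ball p e)" and a: "a \<in> ball p r" and R: "0 < R" "r + R \<le> e"
    and u: "norm u = 1" and M: "\<And>t. norm t < R \<Longrightarrow> norm (f (a + t *s u)) \<le> M"
  shows "norm (cdot (cgrad f a) u) \<le> 4 * M / R"
    and "norm t < R / 4 \<Longrightarrow> norm (f (a + t *s u) - f a - t * cdot (cgrad f a) u) \<le> 128 * M / R\<^sup>2 * norm t ^ 2"
proof -
  have ae: "a \<in> ball p e" using line_in_ball[OF a u, of 0 R e] R by simp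
  note * = holo_line_estimates[where g = "\<lambda>_. 1" and u = u and M = M, OF _ holo_on_const _ R(1) _ _ holo_on_cgrad[OF f ae]]
  note l = line_in_ball[OF a u _ R(2)]
  show "norm (cdot (cgrad f a) u) \<le> 4 * M / R"
    by (rule *(1)) (use f l M in auto)
  show "norm (f (a + t *s u) - f a - t * cdot (cgrad f a) u) \<le> 128 * M / R\<^sup>2 * norm t ^ 2" if "norm t < R / 4"
    by (rule *(2)) (use f l M that in auto)
qed

lemma cgrad_locally_bounded:
  fixes f :: "complex^'n::finite \<Rightarrow> complex"
  assumes "holo_on f S" "open S" "x \<in> S"
  shows "\<exists>C. \<forall>\<^sub>F y in nhds x. norm (cgrad f y) \<le> C"
proof -
  obtain R where R: "0 < R" "ball x R \<subseteq> S" and b: "\<And>y. y \<in> ball x R \<Longrightarrow> norm (f y) \<le> norm (f x) + 1"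
    using holo_on_bounded_ball[OF assms] by blast
  let ?C = "real CARD('n) * (4 * (norm (f x) + 1) / (R/2))"
  have "norm (cgrad f y) \<le> ?C" if y: "y \<in> ball x (R/2)" for y
  proof (rule norm_vec_le_card)
    fix k
    have "norm (cdot (cgrad f y) (axis k 1)) \<le> 4 * (norm (f x) + 1) / (R/2)"
    proof (rule cgrad_line_bound(1)[OF holo_on_subset[OF assms(1) R(2)] y])
      show "norm (f (y + t *s axis k 1)) \<le> norm (f x) + 1" if "norm t < R/2" for t
        using line_in_ball[OF y _ that, of "axis k 1" R] b by simp
    qed (use R in auto)
    then show "norm (cgrad f y $ k) \<le> 4 * (norm (f x) + 1) / (R/2)" by simp
  qed
  then have "\<forall>\<^sub>F y in nhds x. norm (cgrad f y) \<le> ?C"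
    using R by (intro eventually_ballI[of "R/2"]) auto
  then show ?thesis ..
qed

text \<open>A quantitative substitute for writing \<open>f\<close> as \<open>w $ k\<close> times a
  holomorphic function. Taylor expansion along axis \<open>k\<close> from the foot of
  \<open>w\<close> on the hyperplane, where \<open>f\<close> is 0, bounds \<open>f\<close>. Along
  any other axis \<open>w $ k\<close> stays constant, so Cauchy's inequality carries the bound over
  to the tangential derivative.\<close>

lemma vanishing_on_hyperplane:
  fixes f :: "complex^'n::finite \<Rightarrow> complex"
  assumes f: "holo_on f S" "open S" and x: "x \<in> S" "x $ k = 0"
    and zero: "\<And>w. w \<in> S \<Longrightarrow> w $ k = 0 \<Longrightarrow> f w = 0"
  shows "\<exists>C. \<forall>\<^sub>F w in nhds x. norm (f w) \<le> C * norm (w $ k) \<and>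
    (\<forall>l. l \<noteq> k \<longrightarrow> norm (cgrad f w $ l) \<le> C * norm (w $ k))"
proof -
  obtain e where e: "0 < e" "ball x e \<subseteq> S" and b: "\<And>y. y \<in> ball x e \<Longrightarrow> norm (f y) \<le> norm (f x) + 1"
    using holo_on_bounded_ball[OF f x(1)] by blast
  have hf: "holo_on f (ball x e)" using f(1) e(2) by (rule holo_on_subset)
  define R where "R = e / 4"
  define M where "M = norm (f x) + 1"
  have R: "0 < R" "e = 4 * R" and "0 < M" using e by (auto simp: R_def M_def add_nonneg_pos)
  \<comment> \<open>Linear and quadratic term of the Taylor estimate, one factor
    \<open>norm (w $ k)\<close> of the latter being at most \<open>R\<close>.\<close>
  define C where "C = 4 * M / R + 128 * M / R\<^sup>2 * R"
  have "0 < C" using R \<open>0 < M\<close> by (simp add: C_def add_pos_pos)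
  have fw: "norm (f w) \<le> C * norm (w $ k)" if w: "w \<in> ball x (R/4)" for w
  proof -
    let ?t = "w $ k" and ?u = "axis k 1 :: complex^'n" 
    define a where "a = w - ?t *s ?u"
    have "norm ?t \<le> norm (w - x)" using x(2) Finite_Cartesian_Product.norm_nth_le[of "w - x" k] by simp
    then have t: "norm ?t < R / 4" using w by (simp add: dist_norm norm_minus_commute)
    have "w + (- ?t) *s ?u \<in> ball x (2 * R)"
      by (rule line_in_ball[where s = R, OF w]) (use t R in auto)
    then have a: "a \<in> ball x (2 * R)" by (simp add: a_def)
    have "ball x (2 * R) \<subseteq> ball x e" using R by auto
    then have fa: "f a = 0" using a e by (intro zero) (auto simp: a_def)
    have M: "norm (f (a + t *s ?u)) \<le> M" if "norm t < R" for t
      unfolding M_def by (rule b, rule line_in_ball[OF a _ that]) (use R in auto)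
    note est = cgrad_line_bound[OF hf a R(1) _ _ M]
    have w_eq: "a + ?t *s ?u = w" by (simp add: a_def)
    have "norm (f w - f a - ?t * cdot (cgrad f a) ?u) \<le> 128 * M / R\<^sup>2 * norm ?t ^ 2"
      using est(2)[where t = ?t] R t w_eq by simp
    moreover have "norm (cdot (cgrad f a) ?u) \<le> 4 * M / R" using est(1) R by simp
    then have "norm (?t * cdot (cgrad f a) ?u) \<le> norm ?t * (4 * M / R)"
      unfolding norm_mult by (intro mult_left_mono) auto
    ultimately have "norm (f w) \<le> norm ?t * (4 * M / R) + 128 * M / R\<^sup>2 * norm ?t ^ 2"
      using fa norm_triangle_ineq4 by (smt (verit) norm_triangle_ineq2 diff_zero)
    also have "128 * M / R\<^sup>2 * norm ?t ^ 2 \<le> norm ?t * (128 * M / R\<^sup>2 * R)"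
      using t R \<open>0 < M\<close> mult_left_mono[of "norm ?t" R "norm ?t * (128 * M / R\<^sup>2)"]
      by (simp add: power2_eq_square mult_ac)
    finally show ?thesis by (simp add: C_def algebra_simps)
  qed
  have gw: "norm (cgrad f w $ l) \<le> (32 * C / R) * norm (w $ k)"
    if w: "w \<in> ball x (R/8)" and l: "l \<noteq> k" for w l
  proof -
    have "norm (cdot (cgrad f w) (axis l 1)) \<le> 4 * (C * norm (w $ k)) / (R/8)"
    proof (rule cgrad_line_bound(1)[OF hf w])
      fix t :: complex assume t: "norm t < R/8"
      have "w + t *s axis l 1 \<in> ball x (R/4)" by (rule line_in_ball[OF w _ t]) auto
      from fw[OF this] show "norm (f (w + t *s axis l 1)) \<le> C * norm (w $ k)"
        using l by (simp add: axis_def)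
    qed (use R in auto)
    then show ?thesis by simp
  qed
  have "norm (f w) \<le> (C + 32 * C / R) * norm (w $ k) \<and>
      (\<forall>l. l \<noteq> k \<longrightarrow> norm (cgrad f w $ l) \<le> (C + 32 * C / R) * norm (w $ k))"
    if w: "w \<in> ball x (R/8)" for w
  proof -
    have "w \<in> ball x (R/4)" using w R by auto
    moreover have "C * norm (w $ k) \<le> (C + 32 * C / R) * norm (w $ k)"
      "(32 * C / R) * norm (w $ k) \<le> (C + 32 * C / R) * norm (w $ k)"
      using \<open>0 < C\<close> R by (intro mult_right_mono; simp)+
    ultimately show ?thesis using fw gw[OF w] by (meson order_trans)
  qed
  then show ?thesis
    using R by (intro exI[of _ "C + 32 * C / R"] eventually_ballI[of "R/8"]) auto
qed

context quadric
begin

section \<open>Growth of \<open>psi\<close> near the quadric\<close>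

lemma norm_del_le: "norm (del i v) \<le> real CARD('n) * norm v" for v :: "complex^'n option"
  by (rule norm_vec_le_card) (simp add: Finite_Cartesian_Product.norm_nth_le)

lemma nn_bounded: "\<exists>C. \<forall>\<^sub>F y in nhds y0. \<forall>g. norm (nn i y g) \<le> C * norm g"
proof -
  obtain K where K: "0 \<le> K" "\<And>g. norm (B *v g) \<le> norm g * K"
    using bounded_linear.nonneg_bounded[OF matrix_vector_mul_bounded_linear[of B]] by blast
  let ?C = "real CARD('n) * K + K * (norm y0 + 1)"
  have "norm (nn i y g) \<le> ?C * norm g" if "y \<in> ball y0 1" for y g
  proof -
    have y: "norm y \<le> norm y0 + 1"
      using that norm_triangle_sub[of y y0] by (simp add: dist_norm norm_minus_commute)
    have "norm (nn i y g) \<le> norm (del i (B *v g)) + norm ((B *v g) $ i) * norm y"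
      unfolding nn_def by (metis norm_triangle_ineq4 norm_vector_smult)
    also have "\<dots> \<le> real CARD('n) * norm (B *v g) + norm (B *v g) * (norm y0 + 1)"
      by (intro add_mono norm_del_le mult_mono y Finite_Cartesian_Product.norm_nth_le) auto
    also have "\<dots> \<le> real CARD('n) * (norm g * K) + (norm g * K) * (norm y0 + 1)"
      using K by (intro add_mono mult_left_mono mult_right_mono) auto
    finally show ?thesis by (simp add: algebra_simps)
  qed
  then have "\<forall>\<^sub>F y in nhds y0. \<forall>g. norm (nn i y g) \<le> ?C * norm g"
    by (intro eventually_ballI[of 1]) auto
  then show ?thesis ..
qed

lemma norm_ins_le: "norm (ins i c w) \<le> real CARD('n option) * (norm c + norm w)" for w :: "complex^'n"
proof (rule norm_vec_le_card)
  fix m show "norm (ins i c w $ m) \<le> norm c + norm w"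
    by (cases m i rule: other_cases) (auto intro: order_trans[OF Finite_Cartesian_Product.norm_nth_le])
qed

lemma psi_bounded: "\<exists>C\<ge>0. \<forall>\<^sub>F y in nhds y0. \<forall>w. norm (psi i y w) \<le> C * norm w"
proof -
  obtain C where C: "\<forall>\<^sub>F y in nhds y0. \<forall>g. norm (nn i y g) \<le> C * norm g" using nn_bounded by blast
  have "\<forall>\<^sub>F y in nhds y0. norm y \<le> norm y0 + 1" by (intro tendsto_locally_bounded tendsto_ident_at filterlim_ident)
  with C have "\<forall>\<^sub>F y in nhds y0. \<forall>w. norm (psi i y w) \<le>
      (\<bar>C\<bar> * (real CARD('n option) * (norm y0 + 2))) * norm w"
  proof eventually_elim
    case (elim y)
    show ?case
    proof
      fix w :: "complex^'n"
      have 1: "norm (psi i y w) \<le> \<bar>C\<bar> * norm (ins i (- cdot w y) w)"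
        unfolding psi_def using elim(1) by (meson abs_ge_self mult_right_mono norm_ge_zero order_trans)
      have 2: "norm (ins i (- cdot w y) w) \<le> real CARD('n option) * ((norm y0 + 2) * norm w)"
      proof -
        have "norm w * norm y \<le> norm w * (norm y0 + 1)" using elim(2) by (intro mult_left_mono) auto
        then have "norm (- cdot w y) + norm w \<le> (norm y0 + 2) * norm w"
          using norm_cdot_le[of w y] by (simp add: algebra_simps)
        then show ?thesis by (rule order_trans[OF norm_ins_le mult_left_mono]) simp
      qed
      have "norm (psi i y w) \<le> \<bar>C\<bar> * (real CARD('n option) * ((norm y0 + 2) * norm w))"
        using 1 mult_left_mono[OF 2, of "\<bar>C\<bar>"] by linarith
      then show "norm (psi i y w) \<le> (\<bar>C\<bar> * (real CARD('n option) * (norm y0 + 2))) * norm w"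
        by (simp only: mult.assoc)
    qed
  qed
  then show ?thesis by (intro exI[of _ "\<bar>C\<bar> * (real CARD('n option) * (norm y0 + 2))"]) auto
qed

text \<open>In the coordinates \<open>z\<close> the equation of the quadric vanishes on \<open>z\<^sub>k = 0\<close>, so up to \<open>O(z\<^sub>k)\<close> the
  form \<open>dz\<^sub>k\<close> is a multiple of \<open>dq\<close>, on which \<open>psi\<close> is \<open>O(q)\<close>.\<close>

lemma psi_dz_bound:
  fixes \<phi> \<eta> :: "complex^'n \<Rightarrow> complex^'n"
  assumes Y: "open Y" "y0 \<in> Y" and \<phi>: "\<And>l. holo_on (\<lambda>y. \<phi> y $ l) Y"
    and Z: "open Z" "\<phi> ` Y \<subseteq> Z" and \<eta>: "\<And>l. holo_on (\<lambda>w. \<eta> w $ l) Z"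
    and inv: "\<And>y. y \<in> Y \<Longrightarrow> \<eta> (\<phi> y) = y"
    and zero: "\<And>w. w \<in> Z \<Longrightarrow> w $ k = 0 \<Longrightarrow> q i (\<eta> w) = 0" and y0: "\<phi> y0 $ k = 0"
  shows "\<exists>C. \<forall>\<^sub>F y in nhds y0. norm (psi i y (cgrad (\<lambda>y. \<phi> y $ k) y)) \<le> C * norm (\<phi> y $ k)"
proof -
  define h where "h w = q i (\<eta> w)" for w
  let ?g = "\<lambda>l. cgrad (\<lambda>y. \<phi> y $ l)"
  have hh: "holo_on h Z"
    unfolding h_def by (rule holo_on_compose[OF holo_on_q[of i UNIV] \<eta>]) auto
  have qh: "q i y = h (\<phi> y)" if "y \<in> Y" for y using inv that by (simp add: h_def)
  have w0: "\<phi> y0 \<in> Z" using Y Z by auto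
  have lim: "(\<phi> \<longlongrightarrow> \<phi> y0) (nhds y0)"
    using holo_on_tendsto[OF \<phi> Y(2)] by (rule vec_tendstoI)
  have evY: "\<forall>\<^sub>F y in nhds y0. y \<in> Y" using Y by (simp add: eventually_nhds_in_open)
  obtain C1' where "\<forall>\<^sub>F w in nhds (\<phi> y0). norm (h w) \<le> C1' * norm (w $ k) \<and>
      (\<forall>l. l \<noteq> k \<longrightarrow> norm (cgrad h w $ l) \<le> C1' * norm (w $ k))"
    using vanishing_on_hyperplane[OF hh Z(1) w0 y0] zero unfolding h_def by blast
  then have ev1': "\<forall>\<^sub>F y in nhds y0. norm (h (\<phi> y)) \<le> C1' * norm (\<phi> y $ k) \<and>
      (\<forall>l. l \<noteq> k \<longrightarrow> norm (cgrad h (\<phi> y) $ l) \<le> C1' * norm (\<phi> y $ k))"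
    using lim by (rule eventually_compose_filterlim)
  define C1 where "C1 = \<bar>C1'\<bar>"
  have C1: "0 \<le> C1" "C1' * norm (w :: complex) \<le> C1 * norm w" for w
    by (auto simp: C1_def mult_right_mono)
  have ev1: "\<forall>\<^sub>F y in nhds y0. norm (h (\<phi> y)) \<le> C1 * norm (\<phi> y $ k) \<and>
      (\<forall>l. l \<noteq> k \<longrightarrow> norm (cgrad h (\<phi> y) $ l) \<le> C1 * norm (\<phi> y $ k))"
    using ev1' by eventually_elim (meson C1 order_trans)
  have "\<forall>l. \<exists>C. \<forall>\<^sub>F y in nhds y0. norm (?g l y) \<le> C"
    using cgrad_locally_bounded[OF \<phi> Y] by blast
  then obtain c2 where c2: "\<And>l. \<forall>\<^sub>F y in nhds y0. norm (?g l y) \<le> c2 l" by metis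
  define C2 where "C2 = 1 + (\<Sum>l\<in>UNIV. \<bar>c2 l\<bar>)"
  have C2: "0 < C2" "c2 l \<le> C2" for l
    using member_le_sum[of l UNIV "\<lambda>l. \<bar>c2 l\<bar>"] by (auto simp: C2_def add_pos_nonneg sum_nonneg)
  have ev2: "\<forall>\<^sub>F y in nhds y0. \<forall>l. norm (?g l y) \<le> C2"
  proof (rule eventually_all_finite)
    show "\<forall>\<^sub>F y in nhds y0. norm (?g l y) \<le> C2" for l
      using c2[of l] by eventually_elim (use C2(2)[of l] in linarith)
  qed
  obtain C3 where C3: "\<forall>\<^sub>F y in nhds y0. \<forall>g. norm (nn i y g) \<le> C3 * norm g" using nn_bounded by blast
  obtain C4 where C4: "0 \<le> C4" "\<forall>\<^sub>F y in nhds y0. \<forall>w. norm (psi i y w) \<le> C4 * norm w"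
    using psi_bounded by blast
  have "q i y0 = 0" using zero[OF w0 y0] inv Y by simp
  then obtain m where m: "dq i y0 $ m \<noteq> 0" using dq_nonzero by (metis vec_eq_iff zero_index)
  define \<delta> where "\<delta> = norm (dq i y0 $ m) / 2"
  have \<delta>: "0 < \<delta>" using m by (simp add: \<delta>_def)
  have "((\<lambda>y. norm (dq i y $ m)) \<longlongrightarrow> norm (dq i y0 $ m)) (nhds y0)"
    by (intro tendsto_norm holo_on_tendsto[OF holo_on_dq[of i m UNIV]]) simp
  then have ev3: "\<forall>\<^sub>F y in nhds y0. \<delta> < norm (dq i y $ m)"
    by (rule order_tendstoD(1)) (use m in \<open>simp add: \<delta>_def\<close>)
  let ?n = "real CARD('n)"
  have "((\<lambda>y. ?n * (C1 * norm (\<phi> y $ k) * C2)) \<longlongrightarrow> ?n * (C1 * norm (\<phi> y0 $ k) * C2)) (nhds y0)"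
    by (intro tendsto_intros lim)
  then have ev4: "\<forall>\<^sub>F y in nhds y0. ?n * (C1 * norm (\<phi> y $ k) * C2) < \<delta> / 2"
    by (rule order_tendstoD(2)) (use y0 \<delta> in simp)
  \<comment> \<open>The first summand comes from \<open>psi_dq\<close>, with \<open>q\<close>
    bounded by \<open>C1\<close> times \<open>norm (\<phi> y $ k)\<close>; the second from the
    differentials with \<open>l \<noteq> k\<close>. Dividing by the lower bound
    \<open>\<delta> / (2 * C2)\<close> for the \<open>k\<close>-th derivative of \<open>h\<close>
    gives the final constant.\<close>
  define C5 where "C5 = 2 * C1 * \<bar>C3\<bar> + ?n * (C1 * (C4 * C2))"
  have "\<forall>\<^sub>F y in nhds y0. norm (psi i y (?g k y)) \<le> (C5 / (\<delta> / (2 * C2))) * norm (\<phi> y $ k)"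
    using evY ev1 ev2 C3 C4(2) ev3 ev4
  proof eventually_elim
    case (elim y)
    let ?t = "norm (\<phi> y $ k)" and ?c = "cgrad h (\<phi> y)"
    have "has_cgrad (\<lambda>y. h (\<phi> y)) (\<Sum>l\<in>UNIV. ?c $ l *s ?g l y) y"
      using elim(1) Z by (intro has_cgrad_compose holo_on_cgrad[OF hh] holo_on_cgrad[OF \<phi>]) auto
    then have "has_cgrad (q i) (\<Sum>l\<in>UNIV. ?c $ l *s ?g l y) y"
      by (rule has_cgrad_transform[OF _ Y(1) elim(1)]) (simp add: qh)
    then have dq: "dq i y = (\<Sum>l\<in>UNIV. ?c $ l *s ?g l y)"
      using has_cgrad_q cgrad_eq by metis
    then have dq': "dq i y = ?c $ k *s ?g k y + (\<Sum>l\<in>-{k}. ?c $ l *s ?g l y)"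
      by (subst (asm) sum.remove[of _ k]) (auto simp: Compl_eq_Diff_UNIV)
    have off: "norm (\<Sum>l\<in>-{k}. a l) \<le> ?n * b" if "\<And>l. l \<noteq> k \<Longrightarrow> norm (a l) \<le> b" "0 \<le> b" for a b
    proof -
      have "norm (\<Sum>l\<in>-{k}. a l) \<le> of_nat (card (- {k})) * b"
        by (rule order_trans[OF norm_sum sum_bounded_above]) (use that in auto)
      also have "\<dots> \<le> ?n * b" using that(2) by (intro mult_right_mono) (auto intro: card_mono)
      finally show ?thesis .
    qed
    have "\<delta> < norm (?c $ k * ?g k y $ m + (\<Sum>l\<in>-{k}. ?c $ l * ?g l y $ m))"
      using elim(6) unfolding dq' by simp
    also have "\<dots> \<le> norm (?c $ k) * C2 + ?n * (C1 * ?t * C2)"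
    proof (rule norm_triangle_le[OF add_mono])
      have gm: "norm (?g l y $ m) \<le> C2" for l
        using elim(3) Finite_Cartesian_Product.norm_nth_le order_trans by blast
      show "norm (?c $ k * ?g k y $ m) \<le> norm (?c $ k) * C2"
        unfolding norm_mult by (intro mult_left_mono gm) auto
      show "norm (\<Sum>l\<in>-{k}. ?c $ l * ?g l y $ m) \<le> ?n * (C1 * ?t * C2)"
        by (rule off) (use elim(2) gm C1 C2 in \<open>auto simp: norm_mult intro!: mult_mono\<close>)
    qed
    \<comment> \<open>By \<open>ev4\<close> the tangential part is below
      \<open>\<delta> / 2\<close>, so the normal term must supply the other half: the
      \<open>k\<close>-th derivative of \<open>h\<close> stays away from 0, and the chain rule can
      be solved for \<open>psi\<close> of the \<open>k\<close>-th differential.\<close>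
    finally have ck: "\<delta> / (2 * C2) \<le> norm (?c $ k)"
      using elim(7) C2(1) by (simp add: field_simps)
    have "norm (?c $ k) * norm (psi i y (?g k y)) = norm (?c $ k *s psi i y (?g k y))"
      by (simp only: norm_vector_smult)
    also have "?c $ k *s psi i y (?g k y) = psi i y (dq i y) - (\<Sum>l\<in>-{k}. ?c $ l *s psi i y (?g l y))"
      unfolding dq' by (simp add: psi_linear psi_sum)
    also have "norm \<dots> \<le> norm (psi i y (dq i y)) + norm (\<Sum>l\<in>-{k}. ?c $ l *s psi i y (?g l y))"
      by (rule norm_triangle_ineq4)
    also have "\<dots> \<le> 2 * (C1 * ?t) * \<bar>C3\<bar> + ?n * (C1 * ?t * (C4 * C2))"
    proof (rule add_mono)
      have "norm (nn i y (axis i 1)) \<le> \<bar>C3\<bar>" using spec[OF elim(4), of "axis i 1"] by simp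
      then show "norm (psi i y (dq i y)) \<le> 2 * (C1 * ?t) * \<bar>C3\<bar>"
        unfolding psi_dq norm_vector_smult
        using elim(1,2) C1 by (intro mult_mono) (auto simp: norm_mult qh)
      have pl: "norm (psi i y (?g l y)) \<le> C4 * C2" for l
        using spec[OF elim(5), of "?g l y"] mult_left_mono[OF spec[OF elim(3), of l] C4(1)] by linarith
      show "norm (\<Sum>l\<in>-{k}. ?c $ l *s psi i y (?g l y)) \<le> ?n * (C1 * ?t * (C4 * C2))"
      proof (rule off)
        fix l assume "l \<noteq> k"
        then have "norm (?c $ l) \<le> C1 * ?t" using elim(2) by blast
        then show "norm (?c $ l *s psi i y (?g l y)) \<le> C1 * ?t * (C4 * C2)"
          unfolding norm_vector_smult using pl C1(1) by (intro mult_mono) auto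
      qed (use C1(1) C2(1) C4(1) in simp)
    qed
    also have "\<dots> = C5 * ?t" by (simp add: C5_def algebra_simps)
    finally have "norm (?c $ k) * norm (psi i y (?g k y)) \<le> C5 * ?t" .
    then have "\<delta> / (2 * C2) * norm (psi i y (?g k y)) \<le> C5 * ?t"
      using mult_right_mono[OF ck, of "norm (psi i y (?g k y))"] by simp
    then show ?case using \<delta> C2(1) by (simp add: field_simps)
  qed
  then show ?thesis by blast
qed

text \<open>In the expansion of \<open>\<omega>\<close>, terms outside \<open>K\<close> are bounded
  by Cauchy's inequality, and a term of \<open>K\<close> whose coordinate vanishes at
  \<open>y0\<close> is bounded by \<open>psi_dz_bound\<close>. The guard
  \<open>q i y \<noteq> 0\<close> reflects that the expansion holds off the quadric only.\<close>

lemma log_form_psi_bounded: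
  assumes \<omega>: "\<omega> \<in> log_forms proj_space {Q} U" and U: "mopen proj_space U" and y0: "pt i y0 \<in> U"
  shows "\<exists>C. \<forall>\<^sub>F y in nhds y0. q i y \<noteq> 0 \<longrightarrow> norm (psi i y (\<omega> i (pt i y))) \<le> C"
proof -
  obtain W z K u where W: "pt i y0 \<in> W" "W \<subseteq> U" and z: "local_coords proj_space W z"
    and WQ: "W \<inter> Q = {y \<in> W. \<exists>k\<in>K. z y $ k = 0}" and u: "\<And>k. mholo_on proj_space (u k) W"
    and form: "\<And>i p. p \<in> (W - Q) \<inter> dom i \<Longrightarrow> \<omega> i p =
          (\<Sum>k\<in>K. (u k p / z p $ k) *s differential proj_space (\<lambda>q. z q $ k) i p) +
          (\<Sum>k\<in>-K. u k p *s differential proj_space (\<lambda>q. z q $ k) i p)"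
    using \<omega> y0 unfolding log_forms_def by fastforce
  define Y where "Y = {y. pt i y \<in> W}"
  define \<phi> where "\<phi> y = z (pt i y)" for y
  define \<eta> where "\<eta> w = co i (the_inv_into W z w)" for w
  have zi: "inj_on z W" using z by (simp add: local_coords_def)
  have Y: "open Y" "y0 \<in> Y" using z W by (auto simp: local_coords_def mopen_iff Y_def)
  have \<phi>: "holo_on (\<lambda>y. \<phi> y $ l) Y" for l
    using z unfolding local_coords_def mholo_on_iff Y_def \<phi>_def by blast
  have Yim: "pt i ` Y = W \<inter> dom i" by (auto simp: Y_def image_iff) (metis pt_co)
  have \<phi>Y: "\<phi> ` Y = z ` (W \<inter> dom i)" unfolding Yim[symmetric] by (auto simp: \<phi>_def)
  have \<eta>: "holo_on (\<lambda>w. \<eta> w $ l) (\<phi> ` Y)" for l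
    using z unfolding local_coords_def \<phi>Y \<eta>_def by blast
  have inv: "\<eta> (\<phi> y) = y" if "y \<in> Y" for y
    using that zi by (simp add: \<eta>_def \<phi>_def Y_def the_inv_into_f_f)
  \<comment> \<open>The definition of coordinates makes the image of all of \<open>W\<close> open,
    while \<open>Y\<close> covers just the part of \<open>W\<close> in chart \<open>i\<close>;
    invariance of domain gives openness of its image.\<close>
  have Z: "open (\<phi> ` Y)"
  proof (rule invariance_of_domain)
    have "continuous_on Y (\<lambda>y. \<chi> l. \<phi> y $ l)"
      by (rule continuous_on_vec_lambda[where f = "\<lambda>l y. \<phi> y $ l", OF holo_on_continuous_on[OF \<phi>]])
    then show "continuous_on Y \<phi>" by simp
    show "inj_on \<phi> Y" using inv by (rule inj_on_inverseI)
  qed (rule Y)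
  have ub: "\<forall>\<^sub>F y in nhds y0. norm (u k (pt i y)) \<le> norm (u k (pt i y0)) + 1" for k
    using u[of k] Y(2) unfolding mholo_on_iff Y_def
    by (intro tendsto_locally_bounded holo_on_tendsto) auto
  obtain C4 where C4: "0 \<le> C4" "\<forall>\<^sub>F y in nhds y0. \<forall>w. norm (psi i y w) \<le> C4 * norm w"
    using psi_bounded by blast
  let ?g = "\<lambda>l. cgrad (\<lambda>y. \<phi> y $ l)"
  have reg: "\<exists>C. \<forall>\<^sub>F y in nhds y0. norm (u k (pt i y) *s psi i y (?g k y)) \<le> C" for k
  proof -
    obtain C2 where "\<forall>\<^sub>F y in nhds y0. norm (?g k y) \<le> C2"
      using cgrad_locally_bounded[OF \<phi> Y] by blast
    with C4(2) ub[of k]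
    have "\<forall>\<^sub>F y in nhds y0. norm (u k (pt i y) *s psi i y (?g k y)) \<le> (norm (u k (pt i y0)) + 1) * (C4 * C2)"
    proof eventually_elim
      case (elim y)
      have "norm (psi i y (?g k y)) \<le> C4 * C2"
        using elim(1,3) C4(1) by (meson mult_left_mono order_trans)
      then show ?case unfolding norm_vector_smult using elim(2) by (intro mult_mono) auto
    qed
    then show ?thesis by blast
  qed
  have sing: "\<exists>C. \<forall>\<^sub>F y in nhds y0. norm ((u k (pt i y) / \<phi> y $ k) *s psi i y (?g k y)) \<le> C"
    if k: "k \<in> K" for k
  \<comment> \<open>\<open>K\<close> may contain coordinates that do not vanish at
    \<open>y0\<close>; their terms are regular there.\<close>
  proof (cases "\<phi> y0 $ k = 0")
    case True
    have zero: "q i (\<eta> w) = 0" if w: "w \<in> \<phi> ` Y" "w $ k = 0" for w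
    proof -
      obtain y where y: "y \<in> Y" "w = \<phi> y" using w by blast
      then have "pt i y \<in> Q" using WQ k w(2) by (auto simp: Y_def \<phi>_def)
      then show ?thesis using y inv by (simp add: pt_mem_Q)
    qed
    obtain C where "\<forall>\<^sub>F y in nhds y0. norm (psi i y (?g k y)) \<le> C * norm (\<phi> y $ k)"
      using psi_dz_bound[OF Y \<phi> Z order_refl \<eta> inv zero True] by blast
    with ub[of k]
    have "\<forall>\<^sub>F y in nhds y0. norm ((u k (pt i y) / \<phi> y $ k) *s psi i y (?g k y)) \<le>
        (norm (u k (pt i y0)) + 1) * \<bar>C\<bar>"
    proof eventually_elim
      case (elim y)
      show ?case
      \<comment> \<open>Where the denominator vanishes, division gives 0, so the bound is
        trivial.\<close>
      proof (cases "\<phi> y $ k = 0")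
        case False
        have "norm (psi i y (?g k y)) / norm (\<phi> y $ k) \<le> C"
          using elim(2) False by (simp add: divide_le_eq)
        then have "norm (psi i y (?g k y)) / norm (\<phi> y $ k) \<le> \<bar>C\<bar>" by simp
        then have "norm (u k (pt i y)) * (norm (psi i y (?g k y)) / norm (\<phi> y $ k)) \<le>
            (norm (u k (pt i y0)) + 1) * \<bar>C\<bar>"
          using elim(1) by (intro mult_mono) auto
        then show ?thesis by (simp add: norm_vector_smult norm_divide)
      qed simp
    qed
    then show ?thesis by blast
  next
    case False
    obtain C where C: "\<forall>\<^sub>F y in nhds y0. norm (u k (pt i y) *s psi i y (?g k y)) \<le> C" using reg by blast
    have "((\<lambda>y. inverse (\<phi> y $ k)) \<longlongrightarrow> inverse (\<phi> y0 $ k)) (nhds y0)"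
      using holo_on_tendsto[OF \<phi> Y(2)] False by (intro tendsto_inverse)
    from tendsto_locally_bounded[OF this] C
    have "\<forall>\<^sub>F y in nhds y0. norm ((u k (pt i y) / \<phi> y $ k) *s psi i y (?g k y)) \<le>
        (norm (inverse (\<phi> y0 $ k)) + 1) * C"
    proof eventually_elim
      case (elim y)
      have "(u k (pt i y) / \<phi> y $ k) *s psi i y (?g k y) =
          inverse (\<phi> y $ k) *s (u k (pt i y) *s psi i y (?g k y))"
        by (simp add: vec_eq_iff field_simps)
      then have "norm ((u k (pt i y) / \<phi> y $ k) *s psi i y (?g k y)) =
          norm (inverse (\<phi> y $ k)) * norm (u k (pt i y) *s psi i y (?g k y))"
        by (simp only: norm_vector_smult)
      also have "\<dots> \<le> (norm (inverse (\<phi> y0 $ k)) + 1) * C"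
        using elim by (intro mult_mono) auto
      finally show ?case .
    qed
    then show ?thesis by blast
  qed
  define a where "a k y = (if k \<in> K then u k (pt i y) / \<phi> y $ k else u k (pt i y)) *s psi i y (?g k y)" for k y
  have "\<forall>k. \<exists>C. \<forall>\<^sub>F y in nhds y0. norm (a k y) \<le> C"
  proof
    show "\<exists>C. \<forall>\<^sub>F y in nhds y0. norm (a k y) \<le> C" for k
      using reg[of k] sing[of k] unfolding a_def by (cases "k \<in> K") simp_all
  qed
  then obtain c where c: "\<And>k. \<forall>\<^sub>F y in nhds y0. norm (a k y) \<le> c k" by metis
  have "\<forall>\<^sub>F y in nhds y0. \<forall>k. norm (a k y) \<le> c k"
    by (rule eventually_all_finite) (use c in auto)
  moreover have "\<forall>\<^sub>F y in nhds y0. y \<in> Y" using Y by (simp add: eventually_nhds_in_open)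
  ultimately have "\<forall>\<^sub>F y in nhds y0. q i y \<noteq> 0 \<longrightarrow> norm (psi i y (\<omega> i (pt i y))) \<le> (\<Sum>k\<in>UNIV. c k)"
  proof eventually_elim
    case (elim y)
    show ?case
    proof
      assume "q i y \<noteq> 0"
      then have "pt i y \<in> (W - Q) \<inter> dom i" using elim(2) by (simp add: Y_def pt_mem_Q)
      from form[OF this] have "psi i y (\<omega> i (pt i y)) =
         (\<Sum>k\<in>K. (u k (pt i y) / \<phi> y $ k) *s psi i y (?g k y)) + (\<Sum>k\<in>-K. u k (pt i y) *s psi i y (?g k y))"
        by (simp add: psi_linear psi_sum differential_eq \<phi>_def)
      also have "\<dots> = (\<Sum>k\<in>K. a k y) + (\<Sum>k\<in>-K. a k y)"
        by (intro arg_cong2[where f = "(+)"] sum.cong) (auto simp: a_def)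
      also have "\<dots> = (\<Sum>k\<in>UNIV. a k y)"
        using sum.union_disjoint[of K "-K" "\<lambda>k. a k y"] by simp
      finally show "norm (psi i y (\<omega> i (pt i y))) \<le> (\<Sum>k\<in>UNIV. c k)"
        using elim(1) by (simp add: order_trans[OF norm_sum sum_mono])
    qed
  qed
  then show ?thesis by blast
qed

end

section \<open>From twisted vector fields to logarithmic forms\<close>

lemma sections_iff:
  "s \<in> sections proj_space E U \<longleftrightarrow>
    (\<forall>i p. p \<notin> U \<inter> dom i \<longrightarrow> s i p = 0) \<and>
    (\<forall>i k. holo_on (\<lambda>y. s i (pt i y) $ k) {y. pt i y \<in> U}) \<and>
    (\<forall>i j. \<forall>p \<in> U \<inter> dom i \<inter> dom j. s i p = E i j p *v s j p)"
  unfolding sections_def by (simp add: mholo_on_chart_iff)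

lemma dom_cover: obtains i where "p \<in> dom i"
proof -
  have "\<exists>i. hcoord p $ i \<noteq> 0" by (metis hcoord_nonzero vec_eq_iff zero_index)
  then show thesis using that by (auto simp: proj_space_def)
qed

lemma open_Int_preimage_dom:
  assumes "\<And>k. holo_on (\<lambda>w. \<eta> w $ k) Z" "open Z"
  shows "open (Z \<inter> {w. pt i (\<eta> w) \<in> dom j})"
proof -
  have "continuous_on Z \<eta>"
    using continuous_on_vec_lambda[where f = "\<lambda>k w. \<eta> w $ k", OF holo_on_continuous_on[OF assms(1)]] by simp
  from continuous_open_preimage[OF this assms(2) open_pt_dom[of i j]]
  show ?thesis by (simp add: vimage_def)
qed

text \<open>The clause of \<open>local_coords\<close> on an arbitrary chart \<open>j\<close> follows
  by composing the inverse \<open>\<eta>\<close> with the transition from chart \<open>i\<close>, so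
  coordinates can be checked in a single chart.\<close>

lemma local_coords_chart:
  fixes \<zeta> \<eta> :: "complex^'n::finite \<Rightarrow> complex^'n"
  assumes S: "open S" and \<zeta>: "\<And>k. holo_on (\<lambda>y. \<zeta> y $ k) S" and Z: "open (\<zeta> ` S)"
    and \<eta>: "\<And>k. holo_on (\<lambda>w. \<eta> w $ k) (\<zeta> ` S)" and inv: "\<And>y. y \<in> S \<Longrightarrow> \<eta> (\<zeta> y) = y"
  shows "local_coords proj_space (pt i ` S) (\<lambda>p. \<zeta> (co i p))"
proof -
  let ?z = "\<lambda>p. \<zeta> (co i p)"
  have zim: "?z ` pt i ` S = \<zeta> ` S" by (simp add: image_image)
  have inj: "inj_on ?z (pt i ` S)" by (rule inj_on_inverseI[of _ "\<lambda>w. pt i (\<eta> w)"]) (auto simp: inv)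
  have zinv: "the_inv_into (pt i ` S) ?z w = pt i (\<eta> w)" if "w \<in> \<zeta> ` S" for w
    using that inv by (intro the_inv_into_f_eq[OF inj]) auto
  have mh: "mholo_on proj_space (\<lambda>p. ?z p $ k) (pt i ` S)" for k
  proof -
    have "{y. pt i y \<in> pt i ` S} = S" by auto (metis co_pt)
    then have "mholo_on proj_space (\<lambda>p. ?z p $ k) (pt i ` S \<inter> dom i)"
      using \<zeta>[of k] by (intro mholo_on_chart) simp
    moreover have "pt i ` S \<inter> dom i = pt i ` S" by auto
    ultimately show ?thesis by simp
  qed
  have "holo_on (\<lambda>w. co j (the_inv_into (pt i ` S) ?z w) $ k) (?z ` (pt i ` S \<inter> dom j))" for j k
  proof -
    have eq: "?z ` (pt i ` S \<inter> dom j) = \<zeta> ` S \<inter> {w. pt i (\<eta> w) \<in> dom j}"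
      by (auto simp: inv) (metis (mono_tags, lifting) IntI co_pt image_eqI inv)
    have "holo_on (\<lambda>w. co j (pt i (\<eta> w)) $ k) (\<zeta> ` S \<inter> {w. pt i (\<eta> w) \<in> dom j})"
      by (rule holo_on_compose[OF holo_on_transition holo_on_subset[OF \<eta>]]) auto
    then show ?thesis unfolding eq
      by (rule holo_on_transform[OF _ open_Int_preimage_dom[OF \<eta> Z]]) (auto simp: zinv inv)
  qed
  then show ?thesis
    unfolding local_coords_def using mopen_pt_image[OF S] inj mh Z zim by auto
qed

lemma axis_nth_if: "axis i c $ j = (if j = i then c else 0)"
  by (simp add: axis_def)

lemma sum_axis_nth: "(\<Sum>k\<in>I. c k *s axis k 1) $ l = (if l \<in> I then c l else (0 :: complex))"
  for I :: "'n::finite set"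
proof -
  have "(\<Sum>k\<in>I. c k *s axis k 1) $ l = (\<Sum>k\<in>I. if l = k then c k else 0)"
    by (simp add: axis_def if_distrib[of "\<lambda>x. _ * x"] cong: if_cong)
  then show ?thesis by (simp add: sum.delta)
qed

context quadric
begin

text \<open>Both sides of the expansion transform by the cocycle of \<open>dual_bundle\<close>, so
  verifying it in one chart containing \<open>W\<close> suffices.\<close>

lemma log_formsI:
  assumes \<omega>: "\<omega> \<in> one_forms proj_space (U - Q)"
    and loc: "\<And>x. x \<in> U \<Longrightarrow> \<exists>W z K u i. x \<in> W \<and> W \<subseteq> U \<inter> dom i \<and> local_coords proj_space W z \<and>
       W \<inter> Q = {y \<in> W. \<exists>k\<in>K. z y $ k = 0} \<and>
       (\<forall>k. mholo_on proj_space (u k) W) \<and>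
       (\<forall>p \<in> W - Q. \<omega> i p =
          (\<Sum>k\<in>K. (u k p / z p $ k) *s differential proj_space (\<lambda>q. z q $ k) i p) +
          (\<Sum>k\<in>-K. u k p *s differential proj_space (\<lambda>q. z q $ k) i p))"
  shows "\<omega> \<in> log_forms proj_space {Q} U"
  unfolding log_forms_def
proof (intro CollectI conjI ballI)
  show "\<omega> \<in> one_forms proj_space (U - \<Union>{Q})" using \<omega> by simp
  fix x assume "x \<in> U"
  from loc[OF this] obtain W z K u i where W: "x \<in> W" "W \<subseteq> U \<inter> dom i" "local_coords proj_space W z"
    "W \<inter> Q = {y \<in> W. \<exists>k\<in>K. z y $ k = 0}" "\<forall>k. mholo_on proj_space (u k) W"
    and form: "\<And>p. p \<in> W - Q \<Longrightarrow> \<omega> i p =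
          (\<Sum>k\<in>K. (u k p / z p $ k) *s differential proj_space (\<lambda>q. z q $ k) i p) +
          (\<Sum>k\<in>-K. u k p *s differential proj_space (\<lambda>q. z q $ k) i p)"
    by blast
  have "\<omega> j p = (\<Sum>k\<in>K. (u k p / z p $ k) *s differential proj_space (\<lambda>q. z q $ k) j p) +
          (\<Sum>k\<in>-K. u k p *s differential proj_space (\<lambda>q. z q $ k) j p)"
    if p: "p \<in> (W - \<Union>{Q}) \<inter> dom j" for j p
  proof -
    have pi: "p \<in> dom i" and pj: "p \<in> dom j" and pU: "p \<in> U" "p \<in> W - Q" using p W(2) by auto
    have d: "differential proj_space (\<lambda>q. z q $ k) j p =
        dual_bundle (tangent_bundle proj_space) j i p *v differential proj_space (\<lambda>q. z q $ k) i p" for k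
    proof -
      have "holo_on (\<lambda>y. z (pt i y) $ k) {y. pt i y \<in> W}"
        using W(3) unfolding local_coords_def mholo_on_iff by blast
      then have "has_cgrad (\<lambda>y. z (pt i y) $ k) (cgrad (\<lambda>y. z (pt i y) $ k) (co i p)) (co i p)"
        by (rule holo_on_cgrad) (use pi pU in \<open>simp add: pt_co\<close>)
      from differential_transition[OF pj pi, of "\<lambda>q. z q $ k", OF this] show ?thesis .
    qed
    have "\<omega> j p = dual_bundle (tangent_bundle proj_space) j i p *v \<omega> i p"
      using \<omega> pi pj pU unfolding sections_iff by blast
    then show ?thesis
      using form[OF pU(2)] by (simp add: d matrix_vector_simps matrix_vector_sum)
  qed
  then show "\<exists>W z K u. x \<in> W \<and> W \<subseteq> U \<and> local_coords proj_space W z \<and>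
       W \<inter> \<Union>{Q} = {y \<in> W. \<exists>k\<in>K. z y $ k = 0} \<and>
       (\<forall>k. mholo_on proj_space (u k) W) \<and>
       (\<forall>i. \<forall>p \<in> (W - \<Union>{Q}) \<inter> dom i. \<omega> i p =
          (\<Sum>k\<in>K. (u k p / z p $ k) *s differential proj_space (\<lambda>q. z q $ k) i p) +
          (\<Sum>k\<in>-K. u k p *s differential proj_space (\<lambda>q. z q $ k) i p))"
    using W by (intro exI[of _ W] exI[of _ z] exI[of _ K] exI[of _ u]) auto
qed

text \<open>The coordinate change that flattens the quadric to the hyperplane where entry
  \<open>m\<close> is 0.\<close>

definition straighten :: "'n option \<Rightarrow> 'n \<Rightarrow> complex^'n \<Rightarrow> complex^'n" where
  "straighten i m y = (\<chi> k. if k = m then q i y else y $ k)"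

lemma straighten_cgrad:
  "has_cgrad (\<lambda>y. straighten i m y $ k) (if k = m then dq i y else axis k 1) y"
  by (auto simp: straighten_def intro: has_cgrad_q)

text \<open>The trapezoidal rule, which is exact for quadratic polynomials.\<close>

lemma q_diff_along_axis:
  assumes "\<And>k. k \<noteq> m \<Longrightarrow> y $ k = y' $ k"
  shows "q i y - q i y' = (y $ m - y' $ m) * (dq i y $ m + dq i y' $ m) / 2"
proof -
  define t where "t = y $ m - y' $ m"
  let ?E = "axis (other i m) 1 :: complex^'n option" and ?X = "ins i 1 y'"
  have "ins i 1 y = ?X + t *s ?E"
    by (rule vec_option_eqI[of _ i]) (use assms in \<open>auto simp: vec_eq_iff axis_def t_def\<close>)
  moreover have "dq i y $ m = 2 * bil ?E (ins i 1 y)" for y by (simp add: dq_def bil_def)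
  ultimately show ?thesis
    unfolding t_def[symmetric] q_def by (simp add: bil_simps bil_commute[of ?X ?E] algebra_simps)
qed

text \<open>The hypothesis keeps \<open>dq i y $ m\<close> in the open disc about \<open>c\<close>
  whose boundary passes through 0, so neither one value nor a sum of two values is 0. By
  \<open>q_diff_along_axis\<close> the map is then injective on all of \<open>S\<close>; invariance
  of domain makes its image open, and the inverse Jacobian is explicit.\<close>

lemma straighten_coords:
  assumes S: "open S" and y0: "\<And>y. y \<in> S \<Longrightarrow> norm (dq i y $ m - c) < norm c"
  shows "local_coords proj_space (pt i ` S) (\<lambda>p. straighten i m (co i p))"
proof -
  let ?\<zeta> = "straighten i m"
  have nz: "dq i y $ m \<noteq> 0" if "y \<in> S" for y using y0[OF that] by auto
  have inj: "inj_on ?\<zeta> S"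
  proof (rule inj_onI)
    fix y y' assume y: "y \<in> S" "y' \<in> S" and eq: "?\<zeta> y = ?\<zeta> y'"
    have off: "y $ k = y' $ k" if "k \<noteq> m" for k
      using arg_cong[OF eq, of "\<lambda>v. v $ k"] that by (simp add: straighten_def)
    have "q i y - q i y' = 0"
      using arg_cong[OF eq, of "\<lambda>v. v $ m"] by (simp add: straighten_def)
    then have "y $ m - y' $ m = 0 \<or> dq i y $ m + dq i y' $ m = 0"
      using q_diff_along_axis[OF off] by auto
    moreover have "dq i y $ m + dq i y' $ m \<noteq> 0"
    proof
      assume "dq i y $ m + dq i y' $ m = 0"
      then have "(dq i y $ m - c) + (dq i y' $ m - c) = - 2 * c" by (simp add: algebra_simps)
      then have "2 * norm c \<le> norm (dq i y $ m - c) + norm (dq i y' $ m - c)"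
        using norm_triangle_ineq[of "dq i y $ m - c" "dq i y' $ m - c"] by (simp add: norm_mult)
      then show False using y0[OF y(1)] y0[OF y(2)] by linarith
    qed
    ultimately show "y = y'" using off by (metis eq_iff_diff_eq_0 vec_eq_iff)
  qed
  have \<zeta>: "holo_on (\<lambda>y. ?\<zeta> y $ k) S" for k using straighten_cgrad by (rule holo_onI)
  have Z: "open (?\<zeta> ` S)"
  proof (rule invariance_of_domain[OF _ S inj])
    show "continuous_on S ?\<zeta>"
      using continuous_on_vec_lambda[where f = "\<lambda>k y. ?\<zeta> y $ k", OF holo_on_continuous_on[OF \<zeta>]] by simp
  qed
  define \<eta> where "\<eta> = the_inv_into S ?\<zeta>"
  have inv: "\<eta> (?\<zeta> y) = y" if "y \<in> S" for y using inj that by (simp add: \<eta>_def the_inv_into_f_f)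
  have "holo_on (\<lambda>w. \<eta> w $ k) (?\<zeta> ` S)" for k
  proof -
    \<comment> \<open>Rows of the inverse Jacobian. Row \<open>m\<close> solves
      \<open>dw_m = \<Sum> dq_l dy_l\<close> for \<open>dy_m\<close>; adding \<open>dq_m\<close>
      times the axis cancels the term \<open>l = m\<close> of \<open>dq\<close>.\<close>
    define e where "e y k = (if k = m then inverse (dq i y $ m) *s (axis m 1 - dq i y + dq i y $ m *s axis m 1)
        else axis k 1)" for y k
    have "has_cgrad (\<lambda>w. \<eta> w $ k) (e y k) (?\<zeta> y)" if y: "y \<in> S" for y
    proof -
      have "(\<eta> has_derivative (\<lambda>h. \<chi> k. cdot (e y k) h)) (at (?\<zeta> y))"
      proof (rule has_derivative_inverse_on[OF S, where f' = "\<lambda>y h. \<chi> k. cdot (if k = m then dq i y else axis k 1) h"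
            and g' = "\<lambda>y h. \<chi> k. cdot (e y k) h"])
        show "(?\<zeta> has_derivative (\<lambda>h. \<chi> k. cdot (if k = m then dq i y else axis k 1) h)) (at y)" for y
          by (rule has_derivative_vecI) (use straighten_cgrad[unfolded has_cgrad_def] in simp)
        show "(\<lambda>h. \<chi> k. cdot (if k = m then dq i y else axis k 1) h) \<circ> (\<lambda>h. \<chi> k. cdot (e y k) h) = id"
        proof (rule ext, rule vec_eq_iff[THEN iffD2], rule allI)
          fix h k
          let ?t = "inverse (dq i y $ m) * (h $ m - cdot (dq i y) h + dq i y $ m * h $ m)"
          have ev: "(\<chi> k. cdot (e y k) h) = h + (?t - h $ m) *s axis m 1"
            by (auto simp: vec_eq_iff e_def cdot_simps axis_nth_if algebra_simps)
          show "((\<lambda>h. \<chi> k. cdot (if k = m then dq i y else axis k 1) h) \<circ> (\<lambda>h. \<chi> k. cdot (e y k) h)) h $ k = id h $ k"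
            using nz[OF y] unfolding o_def ev by (auto simp: cdot_simps axis_nth_if field_simps)
        qed
      qed (use inv y in auto)
      then have "((\<lambda>w. \<eta> w $ k) has_derivative (\<lambda>h. (\<chi> k. cdot (e y k) h) $ k)) (at (?\<zeta> y))"
        by (rule bounded_linear.has_derivative[OF bounded_linear_vec_nth])
      then show ?thesis by (simp add: has_cgrad_def)
    qed
    then show ?thesis unfolding holo_on_iff by blast
  qed
  from local_coords_chart[OF S \<zeta> Z this inv] show ?thesis .
qed

text \<open>On the quadric \<open>phi\<close> would divide by 0; there and outside the chart the
  value is the 0 that \<open>sections\<close> over \<open>U - Q\<close> prescribes.\<close>

definition to_form :: "'n cproj set \<Rightarrow> ('n cproj, 'n option, 'n) sect \<Rightarrow> ('n cproj, 'n option, 'n) sect" where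
  "to_form U s i p = (if p \<in> (U - Q) \<inter> dom i then phi i (co i p) (s i p) else 0)"

lemma to_form_one_form:
  assumes s: "s \<in> sections proj_space TM2 U" and U: "mopen proj_space U"
  shows "to_form U s \<in> one_forms proj_space (U - Q)"
  unfolding sections_iff
proof (intro conjI allI impI ballI)
  fix i k
  have hs: "holo_on (\<lambda>y. s i (pt i y) $ k) {y. pt i y \<in> U}" for k
    using s unfolding sections_iff by blast
  have o: "open ({y. pt i y \<in> U} \<inter> {y. q i y \<noteq> 0})"
    using U by (intro open_not_Q) (simp add: mopen_iff)
  have "holo_on (\<lambda>y. phi i y (s i (pt i y)) $ k) ({y. pt i y \<in> U} \<inter> {y. q i y \<noteq> 0})"
    by (intro holo_on_phi holo_on_subset[OF hs]) auto
  then have "holo_on (\<lambda>y. to_form U s i (pt i y) $ k) ({y. pt i y \<in> U} \<inter> {y. q i y \<noteq> 0})"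
    by (rule holo_on_transform[OF _ o]) (simp add: to_form_def pt_mem_Q)
  moreover have "{y. pt i y \<in> U - Q} = {y. pt i y \<in> U} \<inter> {y. q i y \<noteq> 0}" by (auto simp: pt_mem_Q)
  ultimately show "holo_on (\<lambda>y. to_form U s i (pt i y) $ k) {y. pt i y \<in> U - Q}" by simp
next
  fix i j p assume p: "p \<in> (U - Q) \<inter> dom i \<inter> dom j"
  then have "s i p = TM2 i j p *v s j p" using s unfolding sections_iff by blast
  then show "to_form U s i p = dual_bundle (tangent_bundle proj_space) i j p *v to_form U s j p"
    using p phi_transition[of p i j "s j p"] by (simp add: to_form_def)
qed (auto simp: to_form_def)

lemma to_form_log_form:
  assumes s: "s \<in> sections proj_space TM2 U" and U: "mopen proj_space U"
  shows "to_form U s \<in> log_forms proj_space {Q} U"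
proof (rule log_formsI[OF to_form_one_form[OF assms]])
  fix x assume x: "x \<in> U"
  obtain i where i: "x \<in> dom i" by (rule dom_cover)
  define y0 where "y0 = co i x"
  have y0: "pt i y0 = x" using i by (simp add: y0_def pt_co)
  have oU: "open {y. pt i y \<in> U}" using U by (simp add: mopen_iff)
  have hs: "holo_on (\<lambda>y. s i (pt i y) $ k) {y. pt i y \<in> U}" for k
    using s unfolding sections_iff by blast
  have in_im: "{y. pt i y \<in> pt i ` S} = S" for S by auto (metis co_pt)
  have mh: "mholo_on proj_space f (pt i ` S)" if "holo_on (\<lambda>y. f (pt i y)) S" for f S
  proof -
    have "mholo_on proj_space f (pt i ` S \<inter> dom i)"
      by (rule mholo_on_chart) (use that in \<open>simp add: in_im\<close>)
    moreover have "pt i ` S \<inter> dom i = pt i ` S" by auto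
    ultimately show ?thesis by simp
  qed
  show "\<exists>W z K u i. x \<in> W \<and> W \<subseteq> U \<inter> dom i \<and> local_coords proj_space W z \<and>
       W \<inter> Q = {y \<in> W. \<exists>k\<in>K. z y $ k = 0} \<and>
       (\<forall>k. mholo_on proj_space (u k) W) \<and>
       (\<forall>p \<in> W - Q. to_form U s i p =
          (\<Sum>k\<in>K. (u k p / z p $ k) *s differential proj_space (\<lambda>q. z q $ k) i p) +
          (\<Sum>k\<in>-K. u k p *s differential proj_space (\<lambda>q. z q $ k) i p))"
  proof (cases "x \<in> Q")
    case False
    \<comment> \<open>Off the quadric the chart coordinates serve, with \<open>K\<close> empty;
      removing \<open>Q\<close> from \<open>S\<close> makes the form regular on the whole
      neighbourhood.\<close>
    define S where "S = {y. pt i y \<in> U} \<inter> {y. q i y \<noteq> 0}"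
    have S: "open S" unfolding S_def using oU by (rule open_not_Q)
    have xS: "x \<in> pt i ` S" using x False y0 pt_mem_Q by (auto simp: S_def intro!: image_eqI[of _ _ y0])
    have lc: "local_coords proj_space (pt i ` S) (\<lambda>p. co i p)"
      using S by (intro local_coords_chart[where \<zeta> = "\<lambda>y. y" and \<eta> = "\<lambda>y. y"]) (auto intro: holo_on_nth)
    have WQ: "pt i ` S \<inter> Q = {}" by (auto simp: S_def pt_mem_Q)
    have u: "mholo_on proj_space (\<lambda>p. phi i (co i p) (s i p) $ k) (pt i ` S)" for k
      by (rule mh) (simp, intro holo_on_phi holo_on_subset[OF hs], auto simp: S_def)
    have d: "differential proj_space (\<lambda>q. co i q $ k) i p = axis k 1" for k p
      by (simp add: differential_eq cgrad_eq[OF has_cgrad_nth])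
    have f: "to_form U s i p = (\<Sum>k\<in>UNIV. phi i (co i p) (s i p) $ k *s axis k 1)" if "p \<in> pt i ` S" for p
      using that by (auto simp: to_form_def S_def pt_mem_Q basis_expansion)
    show ?thesis
      by (rule exI[of _ "pt i ` S"], rule exI[of _ "co i"], rule exI[of _ "{}"],
          rule exI[of _ "\<lambda>k p. phi i (co i p) (s i p) $ k"], rule exI[of _ i])
        (use xS lc WQ u f d in \<open>auto simp: S_def\<close>)
  next
    case True
    then have "q i y0 = 0" using y0 pt_mem_Q by metis
    then obtain m where m: "dq i y0 $ m \<noteq> 0" using dq_nonzero by (metis vec_eq_iff zero_index)
    \<comment> \<open>The second set is the disc condition of \<open>straighten_coords\<close> with
      \<open>c = dq i y0 $ m\<close>.\<close>
    define S where "S = {y. pt i y \<in> U} \<inter> {y. norm (dq i y $ m - dq i y0 $ m) < norm (dq i y0 $ m)}"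
    have S: "open S"
      unfolding S_def by (intro open_Int oU open_Collect_less continuous_intros holo_on_continuous_on holo_on_dq)
    have y0S: "y0 \<in> S" using x y0 m by (simp add: S_def)
    have nz: "dq i y $ m \<noteq> 0" if "y \<in> S" for y using that by (auto simp: S_def)
    have lc: "local_coords proj_space (pt i ` S) (\<lambda>p. straighten i m (co i p))"
      by (rule straighten_coords[OF S, of _ _ "dq i y0 $ m"]) (simp add: S_def)
    have WQ: "pt i ` S \<inter> Q = {p \<in> pt i ` S. \<exists>k\<in>{m}. straighten i m (co i p) $ k = 0}"
      by (auto simp: pt_mem_Q straighten_def)
    define a where "a p = del i (A *v ins i 0 (s i p))" for p
    define b where "b p = bil (ins i 1 (co i p)) (ins i 0 (s i p))" for p
    \<comment> \<open>The form is \<open>a - (b / (2 q)) dq\<close>, where the 2 is the factor in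
      \<open>dq\<close>. Expanding \<open>a\<close> in the basis \<open>dq\<close> and
      \<open>dy_k\<close> for \<open>k \<noteq> m\<close>, the coefficient of \<open>dq\<close> is
      \<open>a_m / dq_m\<close>; multiplied by \<open>q\<close>, it joins \<open>- b / 2\<close> as
      the coefficient of \<open>dq / q\<close>. The other coefficients are
      \<open>a_k - (a_m / dq_m) dq_k\<close>.\<close>
    define u where "u k p = (if k = m then q i (co i p) * (a p $ m / dq i (co i p) $ m) - b p / 2
        else a p $ k - a p $ m / dq i (co i p) $ m * dq i (co i p) $ k)" for k p
    have ha: "holo_on (\<lambda>y. a (pt i y) $ k) S" for k
      unfolding a_def by (simp, intro holo_on_matrix holo_on_ins_compose holo_on_const holo_on_subset[OF hs])
        (auto simp: S_def)
    have hb: "holo_on (\<lambda>y. b (pt i y)) S"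
      unfolding b_def by (simp, intro holo_on_bil holo_on_ins holo_on_ins_compose holo_on_const holo_on_subset[OF hs])
        (auto simp: S_def)
    have "holo_on (\<lambda>y. u k (pt i y)) S" for k
    proof (cases "k = m")
      case True
      then show ?thesis unfolding u_def
        by (simp, intro holo_on_diff holo_on_mult holo_on_divide holo_on_q ha hb holo_on_dq holo_on_const nz) auto
    next
      case False
      then show ?thesis unfolding u_def
        by (simp, intro holo_on_diff holo_on_mult holo_on_divide ha holo_on_dq nz)
    qed
    then have u: "mholo_on proj_space (u k) (pt i ` S)" for k by (rule mh)
    have d: "differential proj_space (\<lambda>q. straighten i m (co i q) $ k) i p =
        (if k = m then dq i (co i p) else axis k 1)" for k p
      unfolding differential_eq co_pt by (rule cgrad_eq[OF straighten_cgrad])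
    have f: "to_form U s i p =
          (\<Sum>k\<in>{m}. (u k p / straighten i m (co i p) $ k) *s differential proj_space (\<lambda>q. straighten i m (co i q) $ k) i p) +
          (\<Sum>k\<in>-{m}. u k p *s differential proj_space (\<lambda>q. straighten i m (co i q) $ k) i p)"
      if p: "p \<in> pt i ` S - Q" for p
    proof -
      obtain y where y: "y \<in> S" "p = pt i y" using p by blast
      have q: "q i y \<noteq> 0" using p y pt_mem_Q by auto
      have pU: "p \<in> (U - Q) \<inter> dom i" using p y by (auto simp: S_def)
      have 1: "to_form U s i p = a p - (b p / q i y) *s ((1 / 2) *s dq i y)"
        using pU y by (simp add: to_form_def phi_def a_def b_def dq_def vec_eq_iff)
      have 2: "(\<Sum>k\<in>-{m}. u k p *s differential proj_space (\<lambda>q. straighten i m (co i q) $ k) i p) =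
          (\<Sum>k\<in>-{m}. u k p *s axis k 1)"
        by (rule sum.cong) (auto simp: d)
      have "straighten i m (co i p) $ m = q i y" "differential proj_space (\<lambda>q. straighten i m (co i q) $ m) i p = dq i y"
        using d[of m p] y(2) by (simp_all add: straighten_def)
      then have 3: "(\<Sum>k\<in>{m}. (u k p / straighten i m (co i p) $ k) *s
          differential proj_space (\<lambda>q. straighten i m (co i q) $ k) i p) = (u m p / q i y) *s dq i y"
        by simp
      show ?thesis
        unfolding 1 2 3
      proof (rule vec_eq_iff[THEN iffD2], rule allI)
        fix l
        show "(a p - (b p / q i y) *s ((1 / 2) *s dq i y)) $ l =
            ((u m p / q i y) *s dq i y + (\<Sum>k\<in>-{m}. u k p *s axis k 1)) $ l"
          unfolding vector_add_component sum_axis_nth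
          using q nz[OF y(1)] by (auto simp: u_def y(2) field_simps)
      qed
    qed
    show ?thesis
      by (rule exI[of _ "pt i ` S"], rule exI[of _ "\<lambda>p. straighten i m (co i p)"], rule exI[of _ "{m}"],
          rule exI[of _ u], rule exI[of _ i])
        (use y0 y0S lc WQ u f in \<open>auto simp: S_def\<close>)
  qed
qed

end

section \<open>The isomorphism\<close>

lemma sections_holo:
  "s \<in> sections proj_space E U \<Longrightarrow> holo_on (\<lambda>y. s i (pt i y) $ k) {y. pt i y \<in> U}"
  unfolding sections_iff by blast

lemma sections_add:
  assumes "s \<in> sections proj_space E U" "t \<in> sections proj_space E U"
  shows "(\<lambda>i p. s i p + t i p) \<in> sections proj_space E U"
  unfolding sections_iff
proof (intro conjI allI impI ballI)
  show "s i p + t i p = 0" if "p \<notin> U \<inter> dom i" for i p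
    using that assms unfolding sections_iff by (metis add_0)
  show "holo_on (\<lambda>y. (s i (pt i y) + t i (pt i y)) $ k) {y. pt i y \<in> U}" for i k
    unfolding vector_add_component by (intro holo_on_add sections_holo[OF assms(1)] sections_holo[OF assms(2)])
  fix i j p assume "p \<in> U \<inter> dom i \<inter> dom j"
  then have "s i p = E i j p *v s j p" "t i p = E i j p *v t j p"
    using assms unfolding sections_iff by blast+
  then show "s i p + t i p = E i j p *v (s j p + t j p)"
    by (simp only: matrix_vector_right_distrib)
qed

lemma sections_scale:
  assumes "s \<in> sections proj_space E U" "mholo_on proj_space f U"
  shows "(\<lambda>i p. f p *s s i p) \<in> sections proj_space E U"
  unfolding sections_iff
proof (intro conjI allI impI ballI)
  show "f p *s s i p = 0" if "p \<notin> U \<inter> dom i" for i p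
    using that assms unfolding sections_iff by (metis vector_smult_rzero)
  show "holo_on (\<lambda>y. (f (pt i y) *s s i (pt i y)) $ k) {y. pt i y \<in> U}" for i k
    unfolding vector_smult_component using assms(2) unfolding mholo_on_iff
    by (intro holo_on_mult sections_holo[OF assms(1)]) blast
  fix i j p assume "p \<in> U \<inter> dom i \<inter> dom j"
  then have "s i p = E i j p *v s j p" using assms unfolding sections_iff by blast
  then show "f p *s s i p = E i j p *v (f p *s s j p)" by (simp only: matrix_vector_scale)
qed

lemma sections_restr:
  assumes "s \<in> sections proj_space E U" "mopen proj_space V" "V \<subseteq> U"
  shows "restr V s \<in> sections proj_space E V"
  unfolding sections_iff
proof (intro conjI allI impI ballI)
  fix i k
  have "holo_on (\<lambda>y. s i (pt i y) $ k) {y. pt i y \<in> U}" using assms unfolding sections_iff by blast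
  then have "holo_on (\<lambda>y. s i (pt i y) $ k) {y. pt i y \<in> V}"
    by (rule holo_on_subset) (use assms in auto)
  then show "holo_on (\<lambda>y. restr V s i (pt i y) $ k) {y. pt i y \<in> V}"
    by (rule holo_on_transform) (use assms in \<open>simp_all add: restr_def mopen_iff\<close>)
next
  fix i p assume "p \<notin> V \<inter> dom i"
  then show "restr V s i p = 0" using assms unfolding sections_iff restr_def by (metis IntI IntD2)
next
  fix i j p assume p: "p \<in> V \<inter> dom i \<inter> dom j"
  then have "s i p = E i j p *v s j p" using assms unfolding sections_iff by blast
  then show "restr V s i p = E i j p *v restr V s j p" using p by (simp add: restr_def)
qed

context quadric
begin

text \<open>\<open>psi\<close> recovers a section from its form off the quadric; continuity and
  density settle the points on it.\<close>

lemma to_form_inj: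
  assumes s: "s \<in> sections proj_space TM2 U" and t: "t \<in> sections proj_space TM2 U"
    and U: "mopen proj_space U" and eq: "to_form U s = to_form U t"
  shows "s = t"
proof (intro ext)
  fix i p
  show "s i p = t i p"
  proof (cases "p \<in> U \<inter> dom i")
    case False
    then show ?thesis using s t unfolding sections_iff by metis
  next
    case True
    define y where "y = co i p"
    have p: "p = pt i y" using True by (simp add: y_def pt_co)
    have "s i (pt i y) $ k = t i (pt i y) $ k" for k
    proof (rule eq_off_Q_imp_eq[where f = "\<lambda>y. s i (pt i y) $ k" and g = "\<lambda>y. t i (pt i y) $ k" and i = i])
      show "open {y. pt i y \<in> U}" using U by (simp add: mopen_iff)
      show y: "y \<in> {y. pt i y \<in> U}" using True p by simp
      show "isCont (\<lambda>y. s i (pt i y) $ k) y" "isCont (\<lambda>y. t i (pt i y) $ k) y"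
        using s t y unfolding sections_iff by (blast intro: holo_on_isCont)+
      fix w assume w: "w \<in> {y. pt i y \<in> U}" "q i w \<noteq> 0"
      have "phi i w (s i (pt i w)) = phi i w (t i (pt i w))"
        using fun_cong[OF fun_cong[OF eq], of i "pt i w"] w by (simp add: to_form_def pt_mem_Q)
      then show "s i (pt i w) $ k = t i (pt i w) $ k" using psi_phi[OF w(2)] by metis
    qed
    then show ?thesis by (simp add: p vec_eq_iff)
  qed
qed

lemma to_form_surj:
  assumes \<omega>: "\<omega> \<in> log_forms proj_space {Q} U" and U: "mopen proj_space U"
  shows "\<exists>s\<in>sections proj_space TM2 U. to_form U s = \<omega>"
proof -
  have \<omega>1: "\<omega> \<in> one_forms proj_space (U - Q)" using \<omega> by (simp add: log_forms_def)
  have oU: "open {y. pt i y \<in> U}" for i using U by (simp add: mopen_iff)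
  have h\<omega>: "holo_on (\<lambda>y. \<omega> i (pt i y) $ k) ({y. pt i y \<in> U} \<inter> {y. q i y \<noteq> 0})" for i k
  proof -
    have "{y. pt i y \<in> U - Q} = {y. pt i y \<in> U} \<inter> {y. q i y \<noteq> 0}" by (auto simp: pt_mem_Q)
    then show ?thesis using \<omega>1 unfolding sections_iff by metis
  qed
  have "\<exists>h. holo_on h {y. pt i y \<in> U} \<and>
      (\<forall>y\<in>{y. pt i y \<in> U}. q i y \<noteq> 0 \<longrightarrow> h y = psi i y (\<omega> i (pt i y)) $ k)" for i k
  proof (rule riemann_extension[OF oU])
    show "holo_on (\<lambda>y. psi i y (\<omega> i (pt i y)) $ k) ({y. pt i y \<in> U} \<inter> {y. q i y \<noteq> 0})"
      by (rule holo_on_psi[OF h\<omega>])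
    show "holo_on (q i) {y. pt i y \<in> U}" by (rule holo_on_q)
    show "\<exists>a\<in>ball p r. q i a \<noteq> 0" if "0 < r" for p r using that by (rule q_dense)
    fix p assume "p \<in> {y. pt i y \<in> U}"
    then obtain C where "\<forall>\<^sub>F y in nhds p. q i y \<noteq> 0 \<longrightarrow> norm (psi i y (\<omega> i (pt i y))) \<le> C"
      using log_form_psi_bounded[OF \<omega> U] by blast
    then obtain e where "e > 0" "\<And>y. dist y p < e \<Longrightarrow> q i y \<noteq> 0 \<Longrightarrow> norm (psi i y (\<omega> i (pt i y))) \<le> C"
      unfolding eventually_nhds_metric by blast
    then show "\<exists>e>0. \<exists>M. \<forall>y\<in>ball p e \<inter> {y. pt i y \<in> U}. q i y \<noteq> 0 \<longrightarrow> norm (psi i y (\<omega> i (pt i y)) $ k) \<le> M"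
      by (intro exI[of _ e] conjI exI[of _ C])
        (auto simp: dist_commute intro: order_trans[OF Finite_Cartesian_Product.norm_nth_le])
  qed
  then obtain h where h: "\<And>i k. holo_on (h i k) {y. pt i y \<in> U}"
    and h_eq: "\<And>i k y. pt i y \<in> U \<Longrightarrow> q i y \<noteq> 0 \<Longrightarrow> h i k y = psi i y (\<omega> i (pt i y)) $ k"
    by (metis mem_Collect_eq)
  define s where "s i p = (if p \<in> U \<inter> dom i then \<chi> k. h i k (co i p) else 0)" for i p
  have s_off: "s i p = psi i (co i p) (\<omega> i p)" if "p \<in> (U - Q) \<inter> dom i" for i p
    using that h_eq[of i "co i p"] mem_Q[of p i] by (simp add: s_def pt_co vec_eq_iff)
  have hs: "holo_on (\<lambda>y. s i (pt i y) $ k) {y. pt i y \<in> U}" for i k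
    by (rule holo_on_transform[OF h oU]) (simp add: s_def)
  have to_form: "to_form U s = \<omega>"
  proof (intro ext)
    fix i p
    show "to_form U s i p = \<omega> i p"
    proof (cases "p \<in> (U - Q) \<inter> dom i")
      case True
      then show ?thesis using mem_Q[of p i] by (simp add: to_form_def s_off phi_psi)
    next
      case False
      then show ?thesis using \<omega>1 unfolding to_form_def sections_iff by metis
    qed
  qed
  have cocycle_off: "s i p = TM2 i j p *v s j p" if p: "p \<in> (U - Q) \<inter> dom i \<inter> dom j" for i j p
  proof -
    have "q i (co i p) \<noteq> 0" using p mem_Q by blast
    have "\<omega> i p = dual_bundle (tangent_bundle proj_space) i j p *v \<omega> j p"
      using p \<omega>1 unfolding sections_iff by blast
    also have "\<omega> j p = phi j (co j p) (s j p)"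
      unfolding to_form[symmetric] using p by (simp add: to_form_def)
    also have "dual_bundle (tangent_bundle proj_space) i j p *v \<dots> = phi i (co i p) (TM2 i j p *v s j p)"
      using p by (intro phi_transition[symmetric]) auto
    finally have "psi i (co i p) (\<omega> i p) = TM2 i j p *v s j p"
      using \<open>q i (co i p) \<noteq> 0\<close> by (simp add: psi_phi)
    then show ?thesis using p s_off by simp
  qed
  \<comment> \<open>The components were extended separately in each chart, so compatibility over the
    quadric is not built in; it is inherited from the complement by continuity and density.\<close>
  have cocycle: "s i p = TM2 i j p *v s j p" if p: "p \<in> U \<inter> dom i \<inter> dom j" for i j p
  proof -
    define y where "y = co j p"
    have py: "pt j y = p" using p by (simp add: y_def pt_co)
    define S where "S = {y. pt j y \<in> U} \<inter> {y. pt j y \<in> dom i}"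
    have S: "open S" "y \<in> S" using p py by (auto simp: S_def oU open_pt_dom)
    have "s i (pt j y) $ k = (TM2 i j (pt j y) *v s j (pt j y)) $ k" for k
    proof (rule eq_off_Q_imp_eq[where f = "\<lambda>y. s i (pt j y) $ k" and g = "\<lambda>y. (TM2 i j (pt j y) *v s j (pt j y)) $ k" and i = j, OF _ _ S])
      have "mholo_on proj_space (\<lambda>p. s i p $ k) (U \<inter> dom i)" by (rule mholo_on_chart) (rule hs)
      then have "holo_on (\<lambda>y. s i (pt j y) $ k) {y. pt j y \<in> U \<inter> dom i}" unfolding mholo_on_iff by blast
      then show "isCont (\<lambda>y. s i (pt j y) $ k) y" by (rule holo_on_isCont) (use p py in auto)
      have "holo_on (\<lambda>y. ins j 1 y $ i * ins j 0 (s j (pt j y)) $ other i k -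
          ins j 0 (s j (pt j y)) $ i * ins j 1 y $ other i k) S"
        by (intro holo_on_diff holo_on_mult holo_on_ins holo_on_ins_compose holo_on_const holo_on_subset[OF hs])
          (auto simp: S_def)
      then have "holo_on (\<lambda>y. (TM2 i j (pt j y) *v s j (pt j y)) $ k) S"
        by (rule holo_on_transform[OF _ S(1)]) (simp add: S_def TM2_mult)
      then show "isCont (\<lambda>y. (TM2 i j (pt j y) *v s j (pt j y)) $ k) y" using S(2) by (rule holo_on_isCont)
      fix w assume "w \<in> S" "q j w \<noteq> 0"
      then have "pt j w \<in> (U - Q) \<inter> dom i \<inter> dom j" by (simp add: S_def pt_mem_Q)
      from cocycle_off[OF this] show "s i (pt j w) $ k = (TM2 i j (pt j w) *v s j (pt j w)) $ k" by simp
    qed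
    then show ?thesis by (simp add: py vec_eq_iff)
  qed
  have "s \<in> sections proj_space TM2 U"
    unfolding sections_iff using hs cocycle by (auto simp: s_def)
  then show ?thesis using to_form by blast
qed

lemma to_form_bij:
  assumes "mopen proj_space U"
  shows "bij_betw (to_form U) (sections proj_space TM2 U) (log_forms proj_space {Q} U)"
  unfolding bij_betw_def
proof
  show "inj_on (to_form U) (sections proj_space TM2 U)"
    by (rule inj_onI) (rule to_form_inj[OF _ _ assms])
  show "to_form U ` sections proj_space TM2 U = log_forms proj_space {Q} U"
    using to_form_log_form[OF _ assms] to_form_surj[OF _ assms] by blast
qed

lemma phi_linear: "phi i y (s + t) = phi i y s + phi i y t" "phi i y (c *s s) = c *s phi i y s"
proof -
  have ins: "ins i 0 (s + t) = ins i 0 s + ins i 0 t" using ins_add[of i 0 0 s t] by simp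
  show "phi i y (s + t) = phi i y s + phi i y t"
    by (rule cdot_eqI) (simp only: cdot_add_left cdot_phi ins H_simps)
  show "phi i y (c *s s) = c *s phi i y s"
    by (rule cdot_eqI) (simp only: cdot_scale_left cdot_phi ins_zero_scale H_simps)
qed

lemma to_form_add: "to_form U (\<lambda>i p. s i p + t i p) = (\<lambda>i p. to_form U s i p + to_form U t i p)"
  by (intro ext) (simp add: to_form_def phi_linear(1))

lemma to_form_scale: "to_form U (\<lambda>i p. f p *s s i p) = (\<lambda>i p. f p *s to_form U s i p)"
  by (intro ext) (simp add: to_form_def phi_linear(2))

lemma to_form_restr: "V \<subseteq> U \<Longrightarrow> to_form V (restr V s) = restr V (to_form U s)"
  by (intro ext) (auto simp: to_form_def restr_def)

text \<open>\<open>F\<close> inverts \<open>to_form\<close> on each open set. Its laws are checked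
  through \<open>F_eq\<close>: the proposed value is a section, and \<open>to_form\<close> maps it
  to the given form.\<close>

theorem log_forms_iso: "sheaf_iso proj_space (log_forms proj_space {Q}) (sections proj_space TM2)"
proof -
  define F where "F U = inv_into (sections proj_space TM2 U) (to_form U)" for U
  have F_eq: "F U \<omega> = s" if "mopen proj_space U" "s \<in> sections proj_space TM2 U" "to_form U s = \<omega>" for U \<omega> s
    unfolding F_def using bij_betw_inv_into_left[OF to_form_bij] that by blast
  have F: "F U \<omega> \<in> sections proj_space TM2 U" "to_form U (F U \<omega>) = \<omega>"
    if "mopen proj_space U" "\<omega> \<in> log_forms proj_space {Q} U" for U \<omega>
    unfolding F_def
    using bij_betw_inv_into_right[OF to_form_bij] bij_betw_apply[OF bij_betw_inv_into[OF to_form_bij]] that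
    by blast+
  show ?thesis
    unfolding sheaf_iso_def
  proof (intro exI[of _ F] allI impI conjI ballI; (elim conjE)?)
    fix U :: "'n cproj set" assume U: "mopen proj_space U"
    show "bij_betw (F U) (log_forms proj_space {Q} U) (sections proj_space TM2 U)"
      unfolding F_def by (rule bij_betw_inv_into[OF to_form_bij[OF U]])
    show "F U (\<lambda>i p. s i p + t i p) = (\<lambda>i p. F U s i p + F U t i p)"
      if "s \<in> log_forms proj_space {Q} U" "t \<in> log_forms proj_space {Q} U" for s t
      by (rule F_eq[OF U]) (use F[OF U] that in \<open>simp_all add: sections_add to_form_add\<close>)
    show "F U (\<lambda>i p. f p *s s i p) = (\<lambda>i p. f p *s F U s i p)"
      if "s \<in> log_forms proj_space {Q} U" "mholo_on proj_space f U" for f s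
      by (rule F_eq[OF U]) (use F[OF U] that in \<open>simp_all add: sections_scale to_form_scale\<close>)
    show "F V (restr V s) = restr V (F U s)"
      if "mopen proj_space V" "V \<subseteq> U" "s \<in> log_forms proj_space {Q} U" for V s
      by (rule F_eq[OF that(1)]) (use F[OF U] sections_restr[OF F(1)[OF U]] that in \<open>simp_all add: to_form_restr\<close>)
  qed
qed

end

section \<open>Smooth quadrics and invertible symmetric matrices\<close>

lemma quadratic_form_matrix:
  assumes "quadratic_form q"
  obtains A :: "complex^'m::finite^'m" where "transpose A = A" "\<And>x. q x = cdot x (A *v x)"
proof -
  obtain a where a: "\<And>x. q x = (\<Sum>i\<in>UNIV. \<Sum>j\<in>UNIV. a i j * x $ i * x $ j)"
    using assms unfolding quadratic_form_def by blast
  \<comment> \<open>The coefficients \<open>a\<close> may be unsymmetric; averaging with the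
    transpose leaves the quadratic form unchanged.\<close>
  define A :: "complex^'m^'m" where "A = (\<chi> i j. (a i j + a j i) / 2)"
  have "q x = cdot x (A *v x)" for x
  proof -
    have "(\<Sum>i\<in>UNIV. \<Sum>j\<in>UNIV. a j i * x $ i * x $ j) = (\<Sum>i\<in>UNIV. \<Sum>j\<in>UNIV. a i j * x $ i * x $ j)"
      by (subst sum.swap) (simp add: mult_ac)
    then have "q x = ((\<Sum>i\<in>UNIV. \<Sum>j\<in>UNIV. a i j * x $ i * x $ j) +
        (\<Sum>i\<in>UNIV. \<Sum>j\<in>UNIV. a j i * x $ i * x $ j)) / 2"
      by (simp add: a)
    also have "\<dots> = (\<Sum>i\<in>UNIV. \<Sum>j\<in>UNIV. (a i j * x $ i * x $ j + a j i * x $ i * x $ j) / 2)"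
      by (simp only: sum.distrib sum_divide_distrib add_divide_distrib)
    also have "\<dots> = cdot x (A *v x)"
    proof -
      have "cdot x (A *v x) = (\<Sum>i\<in>UNIV. \<Sum>j\<in>UNIV. x $ i * ((a i j + a j i) / 2 * x $ j))"
        by (simp add: cdot_def matrix_vector_mult_def A_def sum_distrib_left)
      moreover have "x $ i * ((a i j + a j i) / 2 * x $ j) = (a i j * x $ i * x $ j + a j i * x $ i * x $ j) / 2" for i j
        by (simp add: field_simps)
      ultimately show ?thesis by (simp only:)
    qed
    finally show ?thesis .
  qed
  moreover have "transpose A = A" by (simp add: A_def transpose_def vec_eq_iff add.commute)
  ultimately show thesis using that by blast
qed

text \<open>By symmetry the gradient of \<open>q\<close> at \<open>x\<close> is
  \<open>2 A x\<close>. A nonzero kernel vector of \<open>A\<close> would thus be a zero of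
  \<open>q\<close> with vanishing derivative, which smoothness excludes; the kernel being trivial,
  \<open>A\<close> has an inverse.\<close>

lemma smooth_quadric_imp_quadric:
  assumes "smooth_quadric Q" obtains A B where "quadric A B Q"
proof -
  obtain q where q: "quadratic_form q" and Q: "Q = {p. \<forall>x \<in> Rep_cproj p. q x = 0}"
    and smooth: "\<And>x. x \<noteq> 0 \<Longrightarrow> q x = 0 \<Longrightarrow> \<not> (q has_derivative (\<lambda>_. 0)) (at x)"
    using assms unfolding smooth_quadric_def by blast
  obtain A where sym: "transpose A = A" and qA: "\<And>x. q x = cdot x (A *v x)"
    using quadratic_form_matrix[OF q] by blast
  have "x = 0" if "A *v x = 0" for x
  proof (rule ccontr)
    assume "x \<noteq> 0"
    moreover have "q x = 0" by (simp add: qA that)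
    moreover have "(q has_derivative (\<lambda>_. 0)) (at x)"
    proof -
      have "has_cgrad q (\<Sum>m\<in>UNIV. x $ m *s A $ m + (A *v x) $ m *s axis m 1) x"
        unfolding qA[abs_def] cdot_def matrix_vector_nth
        by (intro has_cgrad_sum has_cgrad_mult has_cgrad_nth has_cgrad_cdot[unfolded cdot_def[abs_def]])
      moreover have "(\<Sum>m\<in>UNIV. x $ m *s A $ m) = A *v x"
      proof -
        have "A $ m $ k = A $ k $ m" for m k
          using arg_cong[OF sym, of "\<lambda>M. M $ k $ m"] by (simp add: transpose_def)
        then show ?thesis
          unfolding vec_eq_iff matrix_vector_mult_def by (simp add: mult.commute cong: sum.cong)
      qed
      ultimately have "has_cgrad q 0 x" by (simp add: that sum.distrib)
      then show ?thesis by (simp add: has_cgrad_def cdot_def[abs_def])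
    qed
    ultimately show False using smooth by blast
  qed
  then obtain B where BA: "B ** A = mat 1" using matrix_left_invertible_ker[of A] by blast
  have Q_iff: "proj x \<in> Q \<longleftrightarrow> cdot x (A *v x) = 0" if x: "x \<noteq> 0" for x
  proof -
    have "(\<forall>v\<in>vec.span {x}. q v = 0) \<longleftrightarrow> q x = 0"
    proof
      assume "\<forall>v\<in>vec.span {x}. q v = 0"
      then show "q x = 0" by (rule bspec) (rule vec.span_base, rule singletonI)
    next
      assume "q x = 0"
      then have "q (c *s x) = 0" for c
        unfolding qA matrix_vector_simps cdot_simps by simp
      then show "\<forall>v\<in>vec.span {x}. q v = 0" by (auto simp: mem_span_singleton)
    qed
    then show ?thesis by (simp add: Q Rep_proj[OF x] qA)
  qed
  have "quadric A B Q"
  proof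
    show "A ** B = mat 1" using BA by (simp only: matrix_left_right_inverse[of A B])
  qed (fact sym BA Q_iff)+
  then show thesis by (rule that)
qed

theorem proposition6p1:
  fixes Q :: "('n::finite) cproj set"
  assumes "smooth_quadric Q"
  shows "sheaf_iso proj_space (log_forms proj_space {Q})
           (sections proj_space (tensor_line (tangent_bundle proj_space) (proj_O (-2))))"
proof -
  obtain A B where "quadric A B Q" using assms by (rule smooth_quadric_imp_quadric)
  then show ?thesis by (rule quadric.log_forms_iso)
qed

end
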